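(* There is an algorithm which, given a finite set $D$, an integer $m$, and a domain $X\subseteq D^m$ (given as an explicit list), decides whether $X$ is an impossibility domain with respect to IIA + Supportiveness + Non-dictatorship, in time $O\big(p(|X|,m,|D|)\cdot|D|^{m\cdot|D|^3}\big)$ for some polynomial $p$.
   Context: For $X\subseteq D^m$, write $D_j=\{x_j:x\in X\}$. An IIA aggregator of arity $n$ is $f=(f_1,\dots,f_m)$ with $f_j:D_j^n\to D_j$ such that for all $x^{(1)},\dots,x^{(n)}\in X$, $(f_1(x^{(1)}_1,\dots,x^{(n)}_1),\dots,f_m(x^{(1)}_m,\dots,x^{(n)}_m))\in X$. It is supportive if $f_j(u_1,\dots,u_n)\in\{u_1,\dots,u_n\}$ for all $j$ and $u_i\in D_j$, and a dictatorship if there is $k\in[n]$ with $f_j(u_1,\dots,u_n)=u_k$ for all $j$ and all arguments. $X$ is an impossibility domain w.r.t. IIA + Supportiveness + Non-dictatorship if for no $n\ge2$ is there a supportive non-dictatorial IIA aggregator for $X$ of arity $n$. *)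

theory Defs
  imports Complex_Main "HOL-Computational_Algebra.Polynomial"
begin

section \<open>Impossibility domains\<close>

text \<open>Coordinates and voters are numbered from 0.  A component \<open>f j\<close> of an aggregator is a total HOL
  function on lists; only its values on \<open>D\<^sub>j\<^sup>n\<close> are ever constrained or inspected.\<close>

definition tuples :: "'a set \<Rightarrow> nat \<Rightarrow> 'a list set" where
  "tuples A n = {u. length u = n \<and> set u \<subseteq> A}"

definition coord :: "'a list set \<Rightarrow> nat \<Rightarrow> 'a set" where
  "coord X j = {x ! j | x. x \<in> X}"

definition iia_aggregator :: "nat \<Rightarrow> 'a list set \<Rightarrow> nat \<Rightarrow> (nat \<Rightarrow> 'a list \<Rightarrow> 'a) \<Rightarrow> bool" where
  "iia_aggregator m X n f \<longleftrightarrow>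
     (\<forall>j<m. \<forall>u\<in>tuples (coord X j) n. f j u \<in> coord X j) \<and>
     (\<forall>P\<in>tuples X n. map (\<lambda>j. f j (map (\<lambda>x. x ! j) P)) [0..<m] \<in> X)"

definition supportive :: "nat \<Rightarrow> 'a list set \<Rightarrow> nat \<Rightarrow> (nat \<Rightarrow> 'a list \<Rightarrow> 'a) \<Rightarrow> bool" where
  "supportive m X n f \<longleftrightarrow> (\<forall>j<m. \<forall>u\<in>tuples (coord X j) n. f j u \<in> set u)"

definition dictatorship :: "nat \<Rightarrow> 'a list set \<Rightarrow> nat \<Rightarrow> (nat \<Rightarrow> 'a list \<Rightarrow> 'a) \<Rightarrow> bool" where
  "dictatorship m X n f \<longleftrightarrow> (\<exists>k<n. \<forall>j<m. \<forall>u\<in>tuples (coord X j) n. f j u = u ! k)"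

definition impossibility_domain :: "nat \<Rightarrow> 'a list set \<Rightarrow> bool" where
  "impossibility_domain m X \<longleftrightarrow>
     \<not> (\<exists>n\<ge>2. \<exists>f. iia_aggregator m X n f \<and> supportive m X n f \<and> \<not> dictatorship m X n f)"

section \<open>Algorithms: while programs over a unit-cost random access machine\<close>

text \<open>A machine state consists of registers and an indirectly addressable memory, all of whose cells
  hold natural numbers.  Multiplication is deliberately not a primitive, so that the uniform cost
  measure is a reasonable one.  Subtraction is truncated at 0.\<close>

record state =
  reg :: "nat \<Rightarrow> nat"
  mem :: "nat \<Rightarrow> nat"

datatype aexp = Const nat | Reg nat | Load aexp | Plus aexp aexp | Minus aexp aexp

datatype bexp = Less aexp aexp | Equal aexp aexp | Not bexp | And bexp bexp

datatype com =
    Skip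
  | Assign nat aexp
  | Store aexp aexp
  | Seq com com
  | Cond bexp com com
  | While bexp com

primrec aval :: "aexp \<Rightarrow> state \<Rightarrow> nat" where
  "aval (Const n) s = n"
| "aval (Reg r) s = reg s r"
| "aval (Load a) s = mem s (aval a s)"
| "aval (Plus a b) s = aval a s + aval b s"
| "aval (Minus a b) s = aval a s - aval b s"

primrec acost :: "aexp \<Rightarrow> nat" where
  "acost (Const n) = 1"
| "acost (Reg r) = 1"
| "acost (Load a) = 1 + acost a"
| "acost (Plus a b) = 1 + acost a + acost b"
| "acost (Minus a b) = 1 + acost a + acost b"

primrec bval :: "bexp \<Rightarrow> state \<Rightarrow> bool" where
  "bval (Less a b) s = (aval a s < aval b s)"
| "bval (Equal a b) s = (aval a s = aval b s)"
| "bval (Not b) s = (\<not> bval b s)"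
| "bval (And b c) s = (bval b s \<and> bval c s)"

primrec bcost :: "bexp \<Rightarrow> nat" where
  "bcost (Less a b) = 1 + acost a + acost b"
| "bcost (Equal a b) = 1 + acost a + acost b"
| "bcost (Not b) = 1 + bcost b"
| "bcost (And b c) = 1 + bcost b + bcost c"

text \<open>\<open>exec c s t s'\<close>: started in \<open>s\<close>, the program \<open>c\<close> halts in \<open>s'\<close> after exactly \<open>t\<close> steps.
  A diverging run has no derivation.\<close>

inductive exec :: "com \<Rightarrow> state \<Rightarrow> nat \<Rightarrow> state \<Rightarrow> bool" where
  exec_Skip: "exec Skip s 1 s"
| exec_Assign: "exec (Assign r a) s (1 + acost a) (s\<lparr>reg := (reg s)(r := aval a s)\<rparr>)"
| exec_Store: "exec (Store a b) s (1 + acost a + acost b)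
    (s\<lparr>mem := (mem s)(aval a s := aval b s)\<rparr>)"
| exec_Seq: "exec c s t s' \<Longrightarrow> exec d s' t' s'' \<Longrightarrow> exec (Seq c d) s (t + t') s''"
| exec_CondT: "bval b s \<Longrightarrow> exec c s t s' \<Longrightarrow> exec (Cond b c d) s (1 + bcost b + t) s'"
| exec_CondF: "\<not> bval b s \<Longrightarrow> exec d s t s' \<Longrightarrow> exec (Cond b c d) s (1 + bcost b + t) s'"
| exec_WhileF: "\<not> bval b s \<Longrightarrow> exec (While b c) s (1 + bcost b) s"
| exec_WhileT: "bval b s \<Longrightarrow> exec c s t s' \<Longrightarrow> exec (While b c) s' t' s'' \<Longrightarrow>
    exec (While b c) s (1 + bcost b + t + t') s''"

inductive_cases exec_SkipE: "exec Skip s t s'"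
inductive_cases exec_AssignE: "exec (Assign r a) s t s'"
inductive_cases exec_StoreE: "exec (Store a b) s t s'"
inductive_cases exec_SeqE: "exec (Seq c d) s t s'"
inductive_cases exec_CondE: "exec (Cond b c d) s t s'"
inductive_cases exec_WhileE: "exec (While b c) s t s'"

lemma exec_deterministic:
  "exec c s t s' \<Longrightarrow> exec c s u s'' \<Longrightarrow> t = u \<and> s' = s''"
proof (induction arbitrary: u s'' rule: exec.induct)
  case (exec_Seq c s t s' d t' s1)
  from exec_Seq.prems show ?case by (rule exec_SeqE) (metis exec_Seq.IH)
next
  case (exec_WhileT b s c t s' t' s1)
  from exec_WhileT.prems show ?case
  proof (rule exec_WhileE)
    fix t1 r t2
    assume u: "u = Suc (bcost b + t1 + t2)" and c: "exec c s t1 r" and w: "exec (While b c) r t2 s''"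
    from c have "t = t1" "s' = r" by (auto dest: exec_WhileT.IH(1))
    from w have "t' = t2 \<and> s1 = s''"
      unfolding \<open>s' = r\<close> [symmetric] by (rule exec_WhileT.IH(2))
    with u \<open>t = t1\<close> show ?thesis by simp
  qed (use exec_WhileT.hyps(1) in simp)
next
  case (exec_WhileF b s c)
  from exec_WhileF.prems show ?case
    by (rule exec_WhileE) (use exec_WhileF.hyps(1) in auto)
next
  case (exec_CondT b s c t s' d)
  from exec_CondT.prems show ?case
    by (rule exec_CondE) (use exec_CondT.hyps(1) exec_CondT.IH in auto)
next
  case (exec_CondF b s d t s' c)
  from exec_CondF.prems show ?case
    by (rule exec_CondE) (use exec_CondF.hyps(1) exec_CondF.IH in auto)
qed (auto elim: exec_SkipE exec_AssignE exec_StoreE)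

text \<open>The input is laid out in memory from address 0 on; everything else is initially 0.
  The answer is read off register 0 (1 for yes, 0 for no).\<close>

definition initial :: "nat list \<Rightarrow> state" where
  "initial l = \<lparr>reg = (\<lambda>_. 0), mem = (\<lambda>i. if i < length l then l ! i else 0)\<rparr>"

definition answers_within :: "com \<Rightarrow> nat list \<Rightarrow> bool \<Rightarrow> real \<Rightarrow> bool" where
  "answers_within c l Q T \<longleftrightarrow>
     (\<exists>t s. exec c (initial l) t s \<and> reg s 0 = (if Q then 1 else 0) \<and> real t \<le> T)"

text \<open>The elements of \<open>D\<close> are named by arbitrary natural numbers.\<close>

definition encode :: "nat list \<Rightarrow> nat \<Rightarrow> nat list list \<Rightarrow> nat list" where
  "encode ds m xs = [length ds, m, length xs] @ ds @ concat xs"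

text \<open>Value of a polynomial in three variables, represented as an iterated univariate one.\<close>

definition poly3 :: "real poly poly poly \<Rightarrow> real \<Rightarrow> real \<Rightarrow> real \<Rightarrow> real" where
  "poly3 p x y z = poly (poly (poly p [:[:x:]:]) [:y:]) z"

end

theory Submission
  imports Defs
begin

text \<open>
  Supportive aggregators of arity three suffice. If no minor of arity \<open>n - 1 \<ge> 3\<close> of an \<open>n\<close>-ary
  supportive non-dictatorial aggregator \<open>f\<close> is non-dictatorial, then by Swierczkowski's argument \<open>f\<close>
  is a projection to some voter \<open>k\<close> on all tuples with a repeated entry. Fix a profile on which \<open>f\<close>
  deviates from voter \<open>k\<close> in favour of voter \<open>l\<close>, and let \<open>f'(x, y)\<close> be \<open>f\<close> with \<open>x\<close> and \<open>y\<close> plugged in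
  for these two voters. Then \<open>f'(x, f'(x, y))\<close> is a supportive non-dictatorial aggregator of arity 2:
  wherever \<open>f'(x, y)\<close> is a vote other than \<open>y\<close>, it is repeated in the outer call, which returns \<open>x\<close>.

  It remains to enumerate all \<open>d ^ (m * d ^ 3)\<close> tables of ternary component functions by counting in
  base \<open>d\<close> and to test each of them in polynomial time.
\<close>

section \<open>Reduction to arity three\<close>

text \<open>The test of a table never leaves the rows of X. Every tuple in D_j^3 is the column at j
  of some triple of rows, so f is supportive and maps X^3 into X as soon as each triple of rows
  yields, coordinate by coordinate, a row w of X all of whose entries are among the three arguments.
  As rows are listed without repetition, voter k is then a dictator iff w always has the index of
  the k-th row. The sets D_j need not be computed: tables are indexed by all of D, and cells for
  arguments outside D_j are never consulted. The machine neither multiplies nor divides, and the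
  elements of D carry arbitrary names. A counter held as one number could not be split into digits
  cheaply, so the table sits in memory, one digit per cell, and is advanced with a carry in O(m d^3)
  operations; a cell is found by scanning all index triples for matching names. One round costs at
  most a power of L = 2 + |X| + m + |D|; only the number of rounds is exponential.\<close>

lemma nth_mem_tuples: "u \<in> tuples A n \<Longrightarrow> i < n \<Longrightarrow> u ! i \<in> A"
  by (auto simp: tuples_def)

lemma tuples_update: "u \<in> tuples A n \<Longrightarrow> a \<in> A \<Longrightarrow> u[i := a] \<in> tuples A n"
  using set_update_subset_insert[of u i a] by (auto simp: tuples_def)

lemma column_in_tuples: "P \<in> tuples X n \<Longrightarrow> map (\<lambda>x. x ! j) P \<in> tuples (coord X j) n"
  by (auto simp: tuples_def coord_def)

lemma ex_profile:
  assumes "u \<in> tuples (coord X j) n"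
  obtains P where "P \<in> tuples X n" "map (\<lambda>x. x ! j) P = u"
proof -
  have "\<forall>a\<in>set u. \<exists>x\<in>X. x ! j = a"
    using assms by (fastforce simp: tuples_def coord_def)
  then obtain h where h: "\<And>a. a \<in> set u \<Longrightarrow> h a \<in> X \<and> h a ! j = a" by metis
  show thesis
    by (rule that[of "map h u"]) (use assms h in \<open>auto simp: tuples_def intro: map_idI\<close>)
qed

definition nondictatorial_aggregator ::
  "nat \<Rightarrow> 'a list set \<Rightarrow> nat \<Rightarrow> (nat \<Rightarrow> 'a list \<Rightarrow> 'a) \<Rightarrow> bool" where
  "nondictatorial_aggregator m X n f \<longleftrightarrow>
     iia_aggregator m X n f \<and> supportive m X n f \<and> \<not> dictatorship m X n f"

lemma supportive_imp_closed:
  "supportive m X n f \<Longrightarrow> j < m \<Longrightarrow> u \<in> tuples (coord X j) n \<Longrightarrow> f j u \<in> coord X j"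
  unfolding supportive_def tuples_def by blast

lemma iia_aggregatorI:
  assumes "supportive m X n f"
    and "\<And>P. P \<in> tuples X n \<Longrightarrow> map (\<lambda>j. f j (map (\<lambda>x. x ! j) P)) [0..<m] \<in> X"
  shows "iia_aggregator m X n f"
  using assms supportive_imp_closed[OF assms(1)] by (auto simp: iia_aggregator_def)

lemma iia_aggregatorD:
  "iia_aggregator m X n f \<Longrightarrow> P \<in> tuples X n \<Longrightarrow> map (\<lambda>j. f j (map (\<lambda>x. x ! j) P)) [0..<m] \<in> X"
  by (simp add: iia_aggregator_def)

text \<open>Let voter q copy voter p: this minor is a supportive aggregator of arity n - 1, hence a
  dictatorship by \<open>dict\<close>, and its dictator is renumbered as a voter of f.\<close>

lemma identify_variables:
  assumes f: "iia_aggregator m X n f" "supportive m X n f"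
    and pq: "p < q" "q < n"
    and dict: "\<And>g. \<not> nondictatorial_aggregator m X (n - 1) g"
  shows "\<exists>e<n. \<forall>j<m. \<forall>u\<in>tuples (coord X j) n. u ! p = u ! q \<longrightarrow> f j u = u ! e"
proof -
  define g where "g j v = f j (take q v @ v ! p # drop q v)" for j v
  have tup: "take q v @ v ! p # drop q v \<in> tuples A n" if "v \<in> tuples A (n - 1)" for v and A :: "'c set"
    using that pq by (auto simp: tuples_def dest: in_set_takeD in_set_dropD)
  have sup: "supportive m X (n - 1) g"
    unfolding supportive_def
  proof (intro allI ballI impI)
    fix j v assume j: "j < m" and v: "v \<in> tuples (coord X j) (n - 1)"
    have "g j v \<in> set (take q v @ v ! p # drop q v)"
      using f(2) tup[OF v] j unfolding g_def supportive_def by blast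
    moreover have "p < length v" using v pq by (auto simp: tuples_def)
    ultimately show "g j v \<in> set v" by (auto dest: in_set_takeD in_set_dropD)
  qed
  have "iia_aggregator m X (n - 1) g"
  proof (rule iia_aggregatorI[OF sup])
    fix P assume P: "P \<in> tuples X (n - 1)"
    have "p < length P" using P pq by (auto simp: tuples_def)
    then have "map (\<lambda>j. g j (map (\<lambda>x. x ! j) P)) [0..<m] =
        map (\<lambda>j. f j (map (\<lambda>x. x ! j) (take q P @ P ! p # drop q P))) [0..<m]"
      by (simp add: g_def take_map drop_map)
    also have "\<dots> \<in> X" by (rule iia_aggregatorD[OF f(1) tup[OF P]])
    finally show "map (\<lambda>j. g j (map (\<lambda>x. x ! j) P)) [0..<m] \<in> X" .
  qed
  then obtain k where k: "k < n - 1"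
    "\<And>j v. j < m \<Longrightarrow> v \<in> tuples (coord X j) (n - 1) \<Longrightarrow> g j v = v ! k"
    using sup dict[of g] unfolding nondictatorial_aggregator_def dictatorship_def by blast
  \<comment> \<open>Position q is missing in the minor, so its voters from q on move up by
    one.\<close>
  define e where "e = (if k < q then k else Suc k)"
  have "f j u = u ! e" if j: "j < m" and u: "u \<in> tuples (coord X j) n" and eq: "u ! p = u ! q" for j u
  proof -
    define v where "v = take q u @ drop (Suc q) u"
    have len: "length u = n" using u by (simp add: tuples_def)
    have "v \<in> tuples (coord X j) (n - 1)"
      using u pq by (auto simp: v_def tuples_def dest: in_set_takeD in_set_dropD)
    moreover have "take q v @ v ! p # drop q v = u"
      using len pq eq by (simp add: v_def nth_append id_take_nth_drop[symmetric])
    ultimately have "f j u = v ! k" using k(2)[OF j, of v] by (simp add: g_def)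
    also have "v ! k = u ! e"
      using len pq k(1) by (auto simp: v_def e_def nth_append min_def)
    finally show ?thesis .
  qed
  moreover have "e < n" using k(1) by (auto simp: e_def)
  ultimately show ?thesis by blast
qed

text \<open>Here \<open>e p q\<close> is the voter that decides whenever voters \<open>p\<close> and \<open>q\<close> agree, and \<open>consistent\<close> comes
  from profiles taking one value on \<open>S\<close> and another one off \<open>S\<close>.\<close>

lemma swierczkowski_index:
  fixes e :: "nat \<Rightarrow> nat \<Rightarrow> nat"
  assumes "4 \<le> n"
    and bound: "\<And>p q. p < n \<Longrightarrow> q < n \<Longrightarrow> p \<noteq> q \<Longrightarrow> e p q < n"
    and consistent: "\<And>p q r s S. p < n \<Longrightarrow> q < n \<Longrightarrow> p \<noteq> q \<Longrightarrow> r < n \<Longrightarrow> s < n \<Longrightarrow> r \<noteq> s \<Longrightarrow>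
      (p \<in> S \<longleftrightarrow> q \<in> S) \<Longrightarrow> (r \<in> S \<longleftrightarrow> s \<in> S) \<Longrightarrow> e p q \<in> S \<longleftrightarrow> e r s \<in> S"
  shows "\<exists>k<n. \<forall>r<n. \<forall>s<n. r \<noteq> s \<longrightarrow> e r s = k \<or> {e r s, k} = {r, s}"
proof -
  have key: "e r s = k \<or> {e r s, k} = {r, s}"
    if pq: "p < n" "q < n" "p \<noteq> q" "e p q = k" "k \<noteq> p" "k \<noteq> q"
      and rs: "r < n" "s < n" "r \<noteq> s" and nq: "{r, s} \<inter> {p, q} \<noteq> {} \<Longrightarrow> k \<noteq> r \<and> k \<noteq> s" for p q r s k
  proof (rule ccontr)
    assume neg: "\<not> ?thesis"
    \<comment> \<open>S contains k and is constant on both pairs, so it must contain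
      \<open>e r s\<close> as well. The larger choice {r, s} is constant on {p, q} because
      \<open>nq\<close> makes the pairs disjoint in that case.\<close>
    define S where "S = (if k \<in> {r, s} then {r, s} else {k})"
    have "p \<in> S \<longleftrightarrow> q \<in> S" using pq nq by (auto simp: S_def)
    moreover have "r \<in> S \<longleftrightarrow> s \<in> S" by (auto simp: S_def)
    ultimately have "e p q \<in> S \<longleftrightarrow> e r s \<in> S" using consistent[of p q r s S] pq rs by blast
    then show False using neg pq rs by (auto simp: S_def split: if_splits)
  qed
  \<comment> \<open>If the pair 0, 1 is decided by one of its own members, then the disjoint pair 2,
    3 is decided by 0 or 1, hence from outside. This uses four voters.\<close>
  obtain p q where pq: "p < n" "q < n" "p \<noteq> q" "e p q \<noteq> p" "e p q \<noteq> q"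
  proof (cases "e 0 1 \<in> {0, 1 :: nat}")
    case True
    have "e 0 1 \<in> {0, 1} \<longleftrightarrow> e 2 3 \<in> {0, 1}"
      using assms(1) by (intro consistent) auto
    with True show thesis using assms(1) that[of 2 3] by force
  next
    case False
    then show thesis using assms(1) that[of 0 1] by auto
  qed
  define k where "k = e p q"
  have kn: "k < n" using bound pq by (simp add: k_def)
  have "e r s = k \<or> {e r s, k} = {r, s}" if rs: "r < n" "s < n" "r \<noteq> s" for r s
  proof (rule ccontr)
    assume neg: "\<not> ?thesis"
    \<comment> \<open>With a fourth voter t, all three pairs inside {p, q, t} are decided by k from
      outside. A pair violating the claim would consist of k and some z lying in each of these
      pairs, but they have no common element.\<close>
    have "card ({..<n} - {k, p, q}) \<ge> 1"
      using assms(1) kn pq by (subst card_Diff_subset) (auto simp: card_insert_if)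
    then obtain t where t: "t < n" "t \<noteq> k" "t \<noteq> p" "t \<noteq> q"
      by (metis Diff_iff card.empty ex_in_conv insertCI lessThan_iff not_one_le_zero)
    have epq: "e p q = k" by (simp add: k_def)
    have ept: "e p t = k"
      using key[of p q k p t] pq t epq by (auto simp: doubleton_eq_iff)
    have eqt: "e q t = k"
      using key[of p q k q t] pq t epq by (auto simp: doubleton_eq_iff)
    have clash: "k \<in> {r, s} \<and> {r, s} \<inter> {a, b} \<noteq> {}"
      if "a < n" "b < n" "a \<noteq> b" "e a b = k" "k \<noteq> a" "k \<noteq> b" for a b
      using key[OF that rs] neg by blast
    have kpq: "k \<noteq> p" "k \<noteq> q" using pq by (simp_all add: k_def)
    note clash = clash[OF pq(1-3) epq kpq]
      clash[OF pq(1) t(1) t(3)[symmetric] ept kpq(1) t(2)[symmetric]]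
      clash[OF pq(2) t(1) t(4)[symmetric] eqt kpq(2) t(2)[symmetric]]
    obtain z where "{r, s} = {k, z}" using clash by blast
    then have "z \<in> {p, q}" "z \<in> {p, t}" "z \<in> {q, t}" using clash kpq t by auto
    then show False using pq t by auto
  qed
  with kn show ?thesis by blast
qed

lemma binary_from_semiprojection:
  assumes f: "iia_aggregator m X n f" "supportive m X n f" and n: "3 \<le> n" and k: "k < n"
    and semi: "\<And>j u. j < m \<Longrightarrow> u \<in> tuples (coord X j) n \<Longrightarrow> \<not> distinct u \<Longrightarrow> f j u = u ! k"
    and j: "j < m" and u: "u \<in> tuples (coord X j) n" and neq: "f j u \<noteq> u ! k"
  shows "\<exists>g. nondictatorial_aggregator m X 2 g"
proof -
  have dist: "distinct u" using semi j u neq by blast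
  have len: "length u = n" using u by (simp add: tuples_def)
  have "f j u \<in> set u" using f(2) j u by (simp add: supportive_def)
  then obtain l where l: "l < n" "f j u = u ! l" by (metis in_set_conv_nth len)
  have kl: "k \<noteq> l" using l neq by auto
  \<comment> \<open>A lifts the tuple u to rows of X, which fixes the votes of the remaining voters
    at all coordinates at once. Replacing rows k and l of A by rows of X gives a profile
    again.\<close>
  obtain A where A: "A \<in> tuples X n" "map (\<lambda>x. x ! j) A = u" using u by (rule ex_profile)
  define B where "B i = map (\<lambda>x. x ! i) A" for i
  have B: "B i \<in> tuples (coord X i) n" for i unfolding B_def by (rule column_in_tuples[OF A(1)])
  have lenB: "length (B i) = n" for i using B by (simp add: tuples_def)
  have Bj: "B j = u" using A by (simp add: B_def)
  define arg where "arg i a b = (B i)[k := a, l := b]" for i a b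
  have arg: "arg i a b \<in> tuples (coord X i) n" if "a \<in> coord X i" "b \<in> coord X i" for i a b
    unfolding arg_def using that B by (intro tuples_update)
  have arg_k: "arg i a b ! k = a" and arg_l: "arg i a b ! l = b" for i a b
    using k l kl lenB by (auto simp: arg_def)
  have arg_other: "arg i a b ! t = B i ! t" if "t \<noteq> k" "t \<noteq> l" for i a b t
    using that by (simp add: arg_def)
  have len_arg: "length (arg i a b) = n" for i a b using lenB by (simp add: arg_def)
  define g where "g i v = f i (arg i (v ! 0) (f i (arg i (v ! 0) (v ! 1))))" for i v
  have supp: "f i (arg i a (f i (arg i a b))) \<in> {a, b}"
    if i: "i < m" and ab: "a \<in> coord X i" "b \<in> coord X i" for i a b
  proof (cases "f i (arg i a b) = b")
    case False
    define w where "w = f i (arg i a b)"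
    have "w \<in> set (arg i a b)" using f(2) i arg[OF ab] by (simp add: supportive_def w_def)
    then obtain t where t: "t < n" "w = arg i a b ! t" by (metis in_set_conv_nth len_arg)
    then have tl: "t \<noteq> l" using False arg_l w_def by metis
    have wX: "w \<in> coord X i" unfolding w_def by (rule supportive_imp_closed[OF f(2) i arg[OF ab]])
    have "arg i a w ! t = arg i a w ! l"
      using t tl arg_k arg_l arg_other by (cases "t = k") auto
    then have "\<not> distinct (arg i a w)" using t tl l len_arg by (metis nth_eq_iff_index_eq)
    then have "f i (arg i a w) = a" using semi[OF i arg[OF ab(1) wX]] arg_k by simp
    then show ?thesis by (simp add: w_def)
  qed simp
  have sup: "supportive m X 2 g"
    unfolding supportive_def
  proof (intro allI ballI impI)
    fix i v assume i: "i < m" and v: "v \<in> tuples (coord X i) 2"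
    have "g i v \<in> {v ! 0, v ! 1}"
      unfolding g_def using v by (intro supp i) (auto intro: nth_mem_tuples)
    then show "g i v \<in> set v" using v by (auto simp: tuples_def)
  qed
  have iia: "iia_aggregator m X 2 g"
  proof (rule iia_aggregatorI[OF sup])
    fix P assume P: "P \<in> tuples X 2"
    have P01: "P ! 0 \<in> X" "P ! 1 \<in> X" using P by (auto intro: nth_mem_tuples)
    have lenP: "length P = 2" using P by (simp add: tuples_def)
    have col: "map (\<lambda>x. x ! i) (A[k := x, l := y]) = arg i (x ! i) (y ! i)" for i x y
      by (simp add: arg_def B_def map_update)
    have app: "map (\<lambda>i. f i (arg i (x ! i) (y ! i))) [0..<m] \<in> X" if "x \<in> X" "y \<in> X" for x y
    proof -
      have "A[k := x, l := y] \<in> tuples X n" using A(1) that by (intro tuples_update)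
      then have "map (\<lambda>i. f i (map (\<lambda>x. x ! i) (A[k := x, l := y]))) [0..<m] \<in> X"
        using f(1) unfolding iia_aggregator_def by blast
      then show ?thesis unfolding col .
    qed
    define w where "w = map (\<lambda>i. f i (arg i (P ! 0 ! i) (P ! 1 ! i))) [0..<m]"
    have "w \<in> X" unfolding w_def using P01 by (rule app)
    then have "map (\<lambda>i. f i (arg i (P ! 0 ! i) (w ! i))) [0..<m] \<in> X" using P01 by (intro app)
    also have "map (\<lambda>i. f i (arg i (P ! 0 ! i) (w ! i))) [0..<m] =
        map (\<lambda>i. g i (map (\<lambda>x. x ! i) P)) [0..<m]"
      using lenP by (simp add: g_def w_def)
    finally show "map (\<lambda>i. g i (map (\<lambda>x. x ! i) P)) [0..<m] \<in> X" .
  qed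
  \<comment> \<open>On (u_k, u_l) both calls of f see u itself and return u_l, so only the second
    argument could dictate. On (u_t, u_l) with a third voter t the vote u_t is repeated, and both
    calls return u_t, which differs from u_l.\<close>
  have "\<not> dictatorship m X 2 g"
  proof
    assume "dictatorship m X 2 g"
    then obtain c where c: "c < 2" "\<And>i v. i < m \<Longrightarrow> v \<in> tuples (coord X i) 2 \<Longrightarrow> g i v = v ! c"
      unfolding dictatorship_def by blast
    have uX: "u ! i \<in> coord X j" if "i < n" for i using u that by (rule nth_mem_tuples)
    have pair: "[u ! s, u ! t] \<in> tuples (coord X j) 2" if "s < n" "t < n" for s t
      using that uX by (auto simp: tuples_def)
    have "arg j (u ! k) (u ! l) = u" by (simp add: arg_def Bj)
    then have "g j [u ! k, u ! l] = u ! l" using l by (simp add: g_def)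
    then have c1: "c = 1" using c(2)[OF j pair[OF k l(1)]] c(1) l neq by (cases c) auto
    have "card ({..<n} - {k, l}) \<ge> 1"
      using n k l kl by (subst card_Diff_subset) (auto simp: card_insert_if)
    then obtain t where t: "t < n" "t \<noteq> k" "t \<noteq> l"
      by (metis Diff_iff card.empty ex_in_conv insertCI lessThan_iff not_one_le_zero)
    have rep: "f j (arg j (u ! t) b) = u ! t" if b: "b \<in> coord X j" for b
    proof -
      have "arg j (u ! t) b ! t = arg j (u ! t) b ! k"
        using t by (simp add: arg_other arg_k Bj)
      then have "\<not> distinct (arg j (u ! t) b)" using t k len_arg by (metis nth_eq_iff_index_eq)
      then show ?thesis using semi[OF j arg[OF uX[OF t(1)] b]] arg_k by simp
    qed
    have "g j [u ! t, u ! l] = u ! t" using rep uX t l by (simp add: g_def)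
    then have "u ! t = u ! l" using c(2)[OF j pair[OF t(1) l(1)]] c1 by simp
    then show False using dist t l len by (metis nth_eq_iff_index_eq)
  qed
  with iia sup show ?thesis unfolding nondictatorial_aggregator_def by blast
qed

text \<open>Used in contraposition: a supportive aggregator without dictator leaves some coordinate
  with two values, from which two-valued test tuples can be built.\<close>

lemma dictatorship_if_trivial:
  assumes "supportive m X n f" "0 < n"
    and "\<And>j a b. j < m \<Longrightarrow> a \<in> coord X j \<Longrightarrow> b \<in> coord X j \<Longrightarrow> a = b"
  shows "dictatorship m X n f"
  unfolding dictatorship_def
proof (intro exI conjI allI ballI impI)
  fix j u assume "j < m" "u \<in> tuples (coord X j) n"
  then show "f j u = u ! 0"
    using assms(3)[of j] supportive_imp_closed[OF assms(1), of j u] nth_mem_tuples[of u _ n 0] assms(2)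
    by blast
qed fact

lemma arity_step:
  assumes f: "nondictatorial_aggregator m X n f" and n: "4 \<le> n"
  shows "(\<exists>g. nondictatorial_aggregator m X (n - 1) g) \<or> (\<exists>g. nondictatorial_aggregator m X 2 g)"
proof (rule ccontr)
  assume "\<not> ?thesis"
  then have none: "\<And>g. \<not> nondictatorial_aggregator m X (n - 1) g"
    and none2: "\<not> (\<exists>g. nondictatorial_aggregator m X 2 g)" by blast+
  have iia: "iia_aggregator m X n f" and sup: "supportive m X n f" and nd: "\<not> dictatorship m X n f"
    using f by (auto simp: nondictatorial_aggregator_def)
  obtain j0 a b where j0: "j0 < m" and ab: "a \<in> coord X j0" "b \<in> coord X j0" "a \<noteq> b"
    using dictatorship_if_trivial[OF sup] nd n by (metis less_le_trans zero_less_numeral)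
  have "\<exists>e<n. \<forall>j<m. \<forall>u\<in>tuples (coord X j) n. u ! p = u ! q \<longrightarrow> f j u = u ! e"
    if "p < n" "q < n" "p \<noteq> q" for p q
  proof (cases "p < q")
    case True
    then show ?thesis using identify_variables[OF iia sup _ _ none] that by blast
  next
    case False
    then have "q < p" using that by simp
    from identify_variables[OF iia sup this \<open>p < n\<close> none] show ?thesis by metis
  qed
  then obtain e where e: "\<And>p q. p < n \<Longrightarrow> q < n \<Longrightarrow> p \<noteq> q \<Longrightarrow> e p q < n"
    "\<And>p q j u. p < n \<Longrightarrow> q < n \<Longrightarrow> p \<noteq> q \<Longrightarrow> j < m \<Longrightarrow> u \<in> tuples (coord X j) n \<Longrightarrow>
       u ! p = u ! q \<Longrightarrow> f j u = u ! e p q"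
    by metis
  have "\<exists>k<n. \<forall>r<n. \<forall>s<n. r \<noteq> s \<longrightarrow> e r s = k \<or> {e r s, k} = {r, s}"
  proof (rule swierczkowski_index[OF n e(1)])
    fix p q r s S
    assume pq: "p < n" "q < n" "p \<noteq> q" and rs: "r < n" "s < n" "r \<noteq> s"
      and S: "(p \<in> S) = (q \<in> S)" "(r \<in> S) = (s \<in> S)"
    \<comment> \<open>The value is a exactly on S, so the result reveals whether the deciding voter
      lies in S. As \<open>e\<close> serves all coordinates, testing at \<open>j0\<close> alone
      suffices.\<close>
    define u where "u = map (\<lambda>i. if i \<in> S then a else b) [0..<n]"
    have u: "u \<in> tuples (coord X j0) n" using ab by (auto simp: u_def tuples_def)
    have nth: "u ! i = (if i \<in> S then a else b)" if "i < n" for i using that by (simp add: u_def)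
    have "f j0 u = u ! e p q" "f j0 u = u ! e r s"
      using pq rs S j0 u by (auto intro!: e(2) simp: nth)
    then show "(e p q \<in> S) = (e r s \<in> S)"
      using ab nth[OF e(1)[OF pq]] nth[OF e(1)[OF rs]] by (auto split: if_splits)
  qed
  then obtain k where k: "k < n" "\<forall>r<n. \<forall>s<n. r \<noteq> s \<longrightarrow> e r s = k \<or> {e r s, k} = {r, s}"
    by blast
  have semi: "f j u = u ! k" if j: "j < m" and u: "u \<in> tuples (coord X j) n" and nd: "\<not> distinct u" for j u
  proof -
    have "length u = n" using u by (simp add: tuples_def)
    then obtain r s where rs: "r < n" "s < n" "r \<noteq> s" "u ! r = u ! s"
      using nd by (auto simp: distinct_conv_nth)
    then have "f j u = u ! e r s" using e(2) j u by blast
    \<comment> \<open>In the second alternative \<open>e r s\<close> and k are r and s in some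
      order, and these two voters agree on u.\<close>
    moreover have "e r s = k \<or> {e r s, k} = {r, s}" using k(2) rs by blast
    ultimately show ?thesis using rs(4) by (auto simp: doubleton_eq_iff)
  qed
  have "\<exists>j<m. \<exists>u\<in>tuples (coord X j) n. f j u \<noteq> u ! k"
    using nd k(1) unfolding dictatorship_def by blast
  then obtain j u where ju: "j < m" "u \<in> tuples (coord X j) n" "f j u \<noteq> u ! k" by blast
  from n have "3 \<le> n" by simp
  from binary_from_semiprojection[OF iia sup this k(1) semi ju] none2 show False by blast
qed

text \<open>The third voter is a dummy. It could dictate only if every coordinate had a single
  value, and then g would be a dictatorship too.\<close>

lemma ternary_from_binary:
  assumes g: "nondictatorial_aggregator m X 2 g"
  shows "nondictatorial_aggregator m X 3 (\<lambda>j u. g j (take 2 u))" (is "nondictatorial_aggregator m X 3 ?h")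
proof -
  have iia: "iia_aggregator m X 2 g" and sup: "supportive m X 2 g" and nd: "\<not> dictatorship m X 2 g"
    using g by (auto simp: nondictatorial_aggregator_def)
  have tk: "take 2 u \<in> tuples A 2" if "u \<in> tuples A 3" for u and A :: "'b set"
    using that by (auto simp: tuples_def dest: in_set_takeD)
  have sup3: "supportive m X 3 ?h"
    using sup tk unfolding supportive_def by (meson in_set_takeD)
  have iia3: "iia_aggregator m X 3 ?h"
    using iia_aggregatorD[OF iia tk] by (intro iia_aggregatorI[OF sup3]) (simp add: take_map)
  have "\<not> dictatorship m X 3 ?h"
  proof
    assume "dictatorship m X 3 ?h"
    then obtain c where c: "c < 3" "\<And>j u. j < m \<Longrightarrow> u \<in> tuples (coord X j) 3 \<Longrightarrow> ?h j u = u ! c"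
      unfolding dictatorship_def by blast
    have c': "g j v = (v @ [a]) ! c" if "j < m" "v \<in> tuples (coord X j) 2" "a \<in> coord X j" for j v a
      using c(2)[of j "v @ [a]"] that by (auto simp: tuples_def)
    show False
    proof (cases "c < 2")
      case True
      have "g j v = v ! c" if "j < m" "v \<in> tuples (coord X j) 2" for j v
        using c'[OF that nth_mem_tuples[OF that(2), of 0]] that True by (auto simp: nth_append tuples_def)
      then show False using nd True unfolding dictatorship_def by blast
    next
      case False
      then have "c = 2" using c by simp
      have "a = b" if "j < m" "a \<in> coord X j" "b \<in> coord X j" for j a b
        using c'[of j "[a, a]" a] c'[of j "[a, a]" b] that \<open>c = 2\<close> by (auto simp: tuples_def)
      then show False using dictatorship_if_trivial[OF sup] nd by simp
    qed
  qed
  with iia3 sup3 show ?thesis by (simp add: nondictatorial_aggregator_def)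
qed

text \<open>Leaves one arity to search: the descent may jump from n to 2, and the dummy voter brings
  it back to 3.\<close>

lemma impossibility_domain_iff_ternary:
  "impossibility_domain m X \<longleftrightarrow> \<not> (\<exists>f. nondictatorial_aggregator m X 3 f)"
proof -
  have "\<exists>g. nondictatorial_aggregator m X 3 g" if "nondictatorial_aggregator m X n f" "2 \<le> n" for n f
    using that
  proof (induction n arbitrary: f rule: less_induct)
    case (less n)
    consider "n = 2" | "n = 3" | "4 \<le> n" using less.prems by linarith
    then show ?case
    proof cases
      case 3
      then have "n - 1 < n" "2 \<le> n - 1" by simp_all
      then show ?thesis
        using arity_step[OF less.prems(1) 3] less.IH ternary_from_binary by blast
    qed (use less.prems ternary_from_binary in blast)+
  qed
  moreover have "2 \<le> (3 :: nat)" by simp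
  ultimately show ?thesis
    unfolding impossibility_domain_def nondictatorial_aggregator_def by blast
qed

section \<open>Time bounds for structured programs\<close>

text \<open>All running times are bounded by powers of one parameter \<open>L \<ge> 2\<close>, so that constants can be
  absorbed into the exponent.\<close>

definition wp :: "nat \<Rightarrow> nat \<Rightarrow> com \<Rightarrow> (state \<Rightarrow> bool) \<Rightarrow> state \<Rightarrow> bool" where
  "wp L k c Q s \<longleftrightarrow> (\<exists>t s'. exec c s t s' \<and> t \<le> L ^ k \<and> Q s')"

lemma wp_mono:
  assumes "wp L k c Q s" "1 \<le> L" "k \<le> k'" "\<And>s'. Q s' \<Longrightarrow> Q' s'"
  shows "wp L k' c Q' s"
  using assms power_increasing[of k k' L] unfolding wp_def by (meson order_trans)

lemma const_le_power:
  assumes "2 \<le> L" "n \<le> 2 ^ k"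
  shows "n \<le> (L :: nat) ^ k"
  using assms power_mono[of 2 L k] by linarith

lemma wp_Skip: "2 \<le> L \<Longrightarrow> Q s \<Longrightarrow> wp L k Skip Q s"
  unfolding wp_def using exec_Skip[of s] by (intro exI[of _ 1] exI[of _ s]) auto

lemma wp_Assign:
  "2 \<le> L \<Longrightarrow> 1 + acost a \<le> 2 ^ k \<Longrightarrow> Q (s\<lparr>reg := (reg s)(r := aval a s)\<rparr>) \<Longrightarrow> wp L k (Assign r a) Q s"
  unfolding wp_def using exec_Assign const_le_power by blast

lemma wp_Store:
  "2 \<le> L \<Longrightarrow> 1 + acost a + acost b \<le> 2 ^ k \<Longrightarrow> Q (s\<lparr>mem := (mem s)(aval a s := aval b s)\<rparr>) \<Longrightarrow>
   wp L k (Store a b) Q s"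
  unfolding wp_def using exec_Store const_le_power by blast

text \<open>Adding two running times costs one unit of the exponent, so exponents measure the
  nesting depth of a program.\<close>

lemma double_power_le: "2 \<le> L \<Longrightarrow> a \<le> L ^ k \<Longrightarrow> b \<le> L ^ k \<Longrightarrow> a + b \<le> (L :: nat) ^ Suc k"
  using mult_le_mono1[of 2 L "L ^ k"] unfolding power_Suc by linarith

lemma wp_Seq:
  assumes "2 \<le> L" "0 < k" "wp L (k - 1) c (wp L (k - 1) d Q) s"
  shows "wp L k (Seq c d) Q s"
proof -
  obtain t s' t' s'' where *: "exec c s t s'" "t \<le> L ^ (k - 1)" "exec d s' t' s''" "t' \<le> L ^ (k - 1)" "Q s''"
    using assms(3) unfolding wp_def by blast
  then have "t + t' \<le> L ^ k" using double_power_le[OF assms(1)] assms(2) by (metis Suc_pred')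
  with * show ?thesis unfolding wp_def by (blast intro: exec_Seq)
qed

lemma wp_Cond:
  assumes "2 \<le> L" "0 < k" "1 + bcost b \<le> 2 ^ (k - 1)"
    and "bval b s \<Longrightarrow> wp L (k - 1) c Q s" "\<not> bval b s \<Longrightarrow> wp L (k - 1) d Q s"
  shows "wp L k (Cond b c d) Q s"
proof -
  obtain t s' where t: "exec (if bval b s then c else d) s t s'" "t \<le> L ^ (k - 1)" "Q s'"
    using assms(4,5) unfolding wp_def by (cases "bval b s") auto
  have "1 + bcost b + t \<le> L ^ k"
    using double_power_le[OF assms(1) const_le_power[OF assms(1,3)] t(2)] assms(2) by simp
  moreover have "exec (Cond b c d) s (1 + bcost b + t) s'"
    using t(1) by (cases "bval b s") (auto intro: exec_CondT[simplified] exec_CondF[simplified])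
  ultimately show ?thesis using t(3) unfolding wp_def by blast
qed

section \<open>Registers and memory that a program leaves unchanged\<close>

primrec writes :: "com \<Rightarrow> nat set" where
  "writes Skip = {}"
| "writes (Assign r a) = {r}"
| "writes (Store a b) = {}"
| "writes (Seq c d) = writes c \<union> writes d"
| "writes (Cond b c d) = writes c \<union> writes d"
| "writes (While b c) = writes c"

primrec storeless :: "com \<Rightarrow> bool" where
  "storeless Skip = True"
| "storeless (Assign r a) = True"
| "storeless (Store a b) = False"
| "storeless (Seq c d) = (storeless c \<and> storeless d)"
| "storeless (Cond b c d) = (storeless c \<and> storeless d)"
| "storeless (While b c) = storeless c"

text \<open>Read off the program text, this relieves invariants of everything constant; they only
  have to describe what changes.\<close>

definition framed :: "com \<Rightarrow> state \<Rightarrow> state \<Rightarrow> bool" where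
  "framed c s s' \<longleftrightarrow> (\<forall>r. r \<notin> writes c \<longrightarrow> reg s' r = reg s r) \<and> (storeless c \<longrightarrow> mem s' = mem s)"

lemma exec_framed: "exec c s t s' \<Longrightarrow> framed c s s'"
  by (induction rule: exec.induct) (auto simp: framed_def)

lemma wp_framed:
  "wp L k c Q s \<Longrightarrow> wp L k c (\<lambda>s'. Q s' \<and> framed c s s') s"
  unfolding wp_def using exec_framed by blast

definition For :: "nat \<Rightarrow> nat \<Rightarrow> com \<Rightarrow> com" where
  "For r b c = Seq (Assign r (Const 0))
     (While (Less (Reg r) (Reg b)) (Seq c (Assign r (Plus (Reg r) (Const 1)))))"

lemma writes_For [simp]: "writes (For r b c) = insert r (writes c)"
  by (auto simp: For_def)

lemma storeless_For [simp]: "storeless (For r b c) = storeless c"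
  by (auto simp: For_def)

text \<open>The cap \<open>L ^ 4\<close> on the number of rounds is what the longest loop, over all
  m * d^3 cells, requires. Of the nine extra exponents four pay for the rounds and four for a
  constant factor 16 <= L^4; one is slack.\<close>

lemma wp_For:
  assumes L: "2 \<le> L" "reg s b \<le> L ^ 4"
    and r: "r \<noteq> b" "r \<notin> writes c" "b \<notin> writes c"
    and init: "I 0 (s\<lparr>reg := (reg s)(r := 0)\<rparr>)"
    and step: "\<And>i s'. i < reg s b \<Longrightarrow> I i s' \<Longrightarrow> reg s' r = i \<Longrightarrow>
      framed (For r b c) s s' \<Longrightarrow>
      wp L k c (\<lambda>s''. I (Suc i) (s''\<lparr>reg := (reg s'')(r := Suc i)\<rparr>)) s'"
  shows "wp L (k + 9) (For r b c) (\<lambda>s'. I (reg s b) s' \<and> framed (For r b c) s s') s"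
proof -
  let ?n = "reg s b"
  let ?w = "While (Less (Reg r) (Reg b)) (Seq c (Assign r (Plus (Reg r) (Const 1))))"
  \<comment> \<open>A round costs \<open>L ^ k\<close> for the body, 4 for the test and 4 for the
    increment; the final 4 is the failing test.\<close>
  have loop: "\<exists>t s''. exec ?w s' t s'' \<and> t \<le> (?n - i) * (L ^ k + 8) + 4 \<and> I ?n s''"
    if "i \<le> ?n" "I i s'" "reg s' r = i" "framed (For r b c) s s'" for i s'
    using that
  proof (induction "?n - i" arbitrary: i s')
    case 0
    then have "i = ?n" by simp
    have "reg s' b = ?n" using 0 r by (simp add: framed_def)
    then have "exec ?w s' (1 + bcost (Less (Reg r) (Reg b))) s'"
      using 0 \<open>i = ?n\<close> by (intro exec_WhileF) simp
    moreover have "1 + bcost (Less (Reg r) (Reg b)) \<le> (?n - i) * (L ^ k + 8) + 4" by simp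
    ultimately show ?case using 0 \<open>i = ?n\<close> by metis
  next
    case (Suc l)
    then have i: "i < ?n" by simp
    have b: "reg s' b = ?n" using Suc.prems r by (simp add: framed_def)
    obtain t1 s1 where s1: "exec c s' t1 s1" "t1 \<le> L ^ k" "I (Suc i) (s1\<lparr>reg := (reg s1)(r := Suc i)\<rparr>)"
      using step[OF i Suc.prems(2-4)] unfolding wp_def by blast
    have fr: "framed c s' s1" using s1(1) by (rule exec_framed)
    define s2 where "s2 = s1\<lparr>reg := (reg s1)(r := Suc i)\<rparr>"
    have "reg s1 r = i" using fr r Suc.prems by (simp add: framed_def)
    then have e2: "exec (Assign r (Plus (Reg r) (Const 1))) s1 4 s2"
      using exec_Assign[of r "Plus (Reg r) (Const 1)" s1] by (simp add: s2_def eval_nat_numeral)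
    have "framed (For r b c) s s2" using fr Suc.prems(4) by (auto simp: framed_def s2_def)
    moreover have "l = ?n - Suc i" "Suc i \<le> ?n" "reg s2 r = Suc i"
      using Suc.hyps(2) i by (simp_all add: s2_def)
    ultimately obtain t3 s3 where s3: "exec ?w s2 t3 s3" "t3 \<le> (?n - Suc i) * (L ^ k + 8) + 4" "I ?n s3"
      using Suc.hyps(1)[of "Suc i" s2] s1(3) unfolding s2_def [symmetric] by blast
    have "exec ?w s' (1 + bcost (Less (Reg r) (Reg b)) + (t1 + 4) + t3) s3"
      using Suc.prems(3) b i by (intro exec_WhileT[OF _ exec_Seq[OF s1(1) e2] s3(1)]) simp
    moreover have "1 + bcost (Less (Reg r) (Reg b)) + (t1 + 4) + t3 \<le> (?n - i) * (L ^ k + 8) + 4"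
    proof -
      have "?n - i = Suc (?n - Suc i)" using i by simp
      then show ?thesis using s1(2) s3(2) by simp
    qed
    ultimately show ?case using s3(3) by blast
  qed
  define s0 where "s0 = s\<lparr>reg := (reg s)(r := 0)\<rparr>"
  have "framed (For r b c) s s0" by (simp add: framed_def s0_def)
  then obtain t s' where s': "exec ?w s0 t s'" "t \<le> (?n - 0) * (L ^ k + 8) + 4" "I ?n s'"
    using loop[of 0 s0] init by (auto simp: s0_def)
  have "exec (Assign r (Const 0)) s 2 s0"
    using exec_Assign[of r "Const 0" s] by (simp add: s0_def eval_nat_numeral)
  from exec_Seq[OF this s'(1)] have e: "exec (For r b c) s (2 + t) s'" by (simp add: For_def)
  have "2 + t \<le> L ^ (k + 9)"
  proof -
    have one: "1 \<le> L ^ k" "1 \<le> L ^ 4" using L by simp_all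
    have "(2 + t) \<le> L ^ 4 * (9 * L ^ k) + 6"
      using s'(2) mult_le_mono[OF L(2), of "L ^ k + 8" "9 * L ^ k"] one by simp
    also have "\<dots> \<le> L ^ 4 * (9 * L ^ k) + 6 * (L ^ 4 * L ^ k)"
      using mult_le_mono[OF one] by simp
    also have "\<dots> \<le> 16 * (L ^ 4 * L ^ k)" by simp
    also have "\<dots> \<le> L ^ 4 * (L ^ 4 * L ^ k)"
      using power_mono[OF L(1), of 4] by (intro mult_le_mono1) simp
    also have "\<dots> = L ^ (k + 8)" by (simp add: power_add)
    also have "\<dots> \<le> L ^ (k + 9)" using L by (intro power_increasing) auto
    finally show ?thesis .
  qed
  with e s'(3) exec_framed[OF e] show ?thesis unfolding wp_def by blast
qed

text \<open>All searches of the program are loops that raise 0/1 flags and never lower them.\<close>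

lemma wp_For_flags:
  assumes L: "2 \<le> L" "n \<le> L ^ 4"
    and r: "r \<noteq> b" "r \<notin> writes c" "b \<notin> writes c" "r \<notin> F" and n: "reg s b = n"
    and init: "\<forall>f\<in>F. reg s f = of_bool (g f)"
    and step: "\<And>i s' h. i < n \<Longrightarrow> \<forall>f\<in>F. reg s' f = of_bool (h f) \<Longrightarrow> reg s' r = i \<Longrightarrow>
      framed (For r b c) s s' \<Longrightarrow> wp L k c (\<lambda>s''. \<forall>f\<in>F. reg s'' f = of_bool (h f \<or> R f i)) s'"
    and K: "k + 9 \<le> K"
    and post: "\<And>s'. \<forall>f\<in>F. reg s' f = of_bool (g f \<or> (\<exists>i<n. R f i)) \<Longrightarrow>
      framed (For r b c) s s' \<Longrightarrow> Q s'"
  shows "wp L K (For r b c) Q s"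
proof -
  define I where "I i s' \<longleftrightarrow> (\<forall>f\<in>F. reg s' f = of_bool (g f \<or> (\<exists>i'<i. R f i')))" for i and s' :: state
  have "wp L (k + 9) (For r b c) (\<lambda>s'. I (reg s b) s' \<and> framed (For r b c) s s') s"
  proof (rule wp_For[OF L(1) _ r(1-3)])
    show "I 0 (s\<lparr>reg := (reg s)(r := 0)\<rparr>)" using init r(4) by (auto simp: I_def)
  next
    fix i s' assume i: "i < reg s b" and I: "I i s'" and ri: "reg s' r = i" and fr: "framed (For r b c) s s'"
    have i': "i < n" using i n by simp
    have "wp L k c (\<lambda>s''. \<forall>f\<in>F. reg s'' f = of_bool ((g f \<or> (\<exists>i'<i. R f i')) \<or> R f i)) s'"
      using step[OF i' _ ri fr, of "\<lambda>f. g f \<or> (\<exists>i'<i. R f i')"] I unfolding I_def by blast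
    then show "wp L k c (\<lambda>s''. I (Suc i) (s''\<lparr>reg := (reg s'')(r := Suc i)\<rparr>)) s'"
      by (rule wp_mono) (use L(1) r(4) in \<open>auto simp: I_def less_Suc_eq\<close>)
  qed (use n L in auto)
  then show ?thesis
    by (rule wp_mono) (use L(1) K n post in \<open>auto simp: I_def\<close>)
qed

text \<open>The register \<open>t\<close> counts the additions, so \<open>a\<close> should name the smaller factor.\<close>

definition Mul :: "nat \<Rightarrow> nat \<Rightarrow> nat \<Rightarrow> nat \<Rightarrow> com" where
  "Mul t r a b = Seq (Assign r (Const 0)) (For t a (Assign r (Plus (Reg r) (Reg b))))"

lemma writes_Mul [simp]: "writes (Mul t r a b) = {t, r}"
  by (auto simp: Mul_def)

lemma storeless_Mul [simp]: "storeless (Mul t r a b)"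
  by (auto simp: Mul_def)

lemma wp_Mul:
  assumes L: "2 \<le> L" "reg s a \<le> L ^ 4" and ne: "distinct [t, r, a]" "distinct [t, r, b]" and k: "20 \<le> k"
    and Q: "Q (s\<lparr>reg := (reg s)(r := reg s a * reg s b, t := reg s a)\<rparr>)"
  shows "wp L k (Mul t r a b) Q s"
proof -
  define s0 where "s0 = s\<lparr>reg := (reg s)(r := 0)\<rparr>"
  define I where "I i s' \<longleftrightarrow> s' = s\<lparr>reg := (reg s)(r := i * reg s b, t := i)\<rparr>" for i s'
  have a: "reg s0 a = reg s a" using ne by (auto simp: s0_def)
  have "wp L (4 + 9) (For t a (Assign r (Plus (Reg r) (Reg b))))
      (\<lambda>s'. I (reg s0 a) s' \<and> framed (For t a (Assign r (Plus (Reg r) (Reg b)))) s0 s') s0"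
    using L ne a by (intro wp_For) (auto simp: I_def s0_def fun_upd_twist add.commute intro!: wp_Assign)
  then have "wp L (k - 1) (For t a (Assign r (Plus (Reg r) (Reg b)))) Q s0"
    by (rule wp_mono) (use L k Q a in \<open>auto simp: I_def\<close>)
  moreover have "(4 :: nat) \<le> 2 ^ (k - 1)" using power_increasing[of 2 "k - 1" "2 :: nat"] k by simp
  ultimately show ?thesis
    unfolding Mul_def using L k by (intro wp_Seq wp_Assign) (auto simp: s0_def)
qed

section \<open>The program\<close>

declare One_nat_def [simp del]

text \<open>
  Registers: 2--4 and 9 hold \<open>m\<close>, \<open>|X|\<close>, the address of the list \<open>X\<close>, and \<open>d = |D|\<close>; 5 and 6 hold the
  address and the length of the table; 10--13 the indices of the rows \<open>x\<close>, \<open>y\<close>, \<open>z\<close> and of the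
  candidate outcome \<open>w\<close>; 14 the coordinate; 15--17 the indices of the arguments of a table cell.
  Flags: 7 a suitable table was found; 8 the counter has overflowed; 20 some triple has no outcome in
  \<open>X\<close>; 21--23 some outcome differs from its first, second, third argument; 24 the current triple
  has an outcome; 25 the candidate is not the outcome; 26 carry.
\<close>

primrec block :: "com list \<Rightarrow> com" where
  "block [] = Skip"
| "block (c # cs) = Seq c (block cs)"

section \<open>Reading rows and table cells\<close>

definition fetch :: "nat \<Rightarrow> nat \<Rightarrow> com" where
  "fetch r x = Seq (Mul 39 r 2 x) (Assign r (Load (Plus (Reg 4) (Plus (Reg r) (Reg 14)))))"

lemma wp_fetch:
  assumes "2 \<le> L" "reg s 2 \<le> L ^ 4" "r \<notin> {2, 4, 14, 39}" "x \<notin> {39, r}" "21 \<le> k"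
    and "Q (s\<lparr>reg := (reg s)(39 := reg s 2, r := mem s (reg s 4 + (reg s 2 * reg s x + reg s 14)))\<rparr>)"
  shows "wp L k (fetch r x) Q s"
proof -
  have "2 ^ 3 \<le> (2 :: nat) ^ (k - 1)" using assms(5) by (intro power_increasing) simp_all
  then have "(7 :: nat) \<le> 2 ^ (k - 1)" by simp
  then show ?thesis
    unfolding fetch_def using assms
    by (intro wp_Seq wp_Mul wp_Assign) (auto simp: fun_upd_twist)
qed

definition locate :: com where
  "locate = block [Mul 39 34 9 14, Assign 34 (Plus (Reg 34) (Reg 15)),
     Mul 39 35 9 34, Assign 35 (Plus (Reg 35) (Reg 16)),
     Mul 39 36 9 35, Assign 36 (Plus (Reg 36) (Reg 17))]"

text \<open>Horner form of the base-d numeral with digits j, a, b, c, matching the three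
  multiplications of \<open>locate\<close>; it numbers the m * d^3 cells.\<close>

definition cell_index :: "nat \<Rightarrow> nat \<Rightarrow> nat \<Rightarrow> nat \<Rightarrow> nat \<Rightarrow> nat" where
  "cell_index d j a b c = d * (d * (d * j + a) + b) + c"

lemma wp_locate:
  assumes "2 \<le> L" "reg s 9 \<le> L ^ 4"
    and post: "\<And>s'. reg s' 36 = cell_index (reg s 9) (reg s 14) (reg s 15) (reg s 16) (reg s 17) \<Longrightarrow>
      \<forall>r. r \<notin> {34, 35, 36, 39} \<longrightarrow> reg s' r = reg s r \<Longrightarrow> mem s' = mem s \<Longrightarrow> Q s'"
    and k: "30 \<le> k"
  shows "wp L k locate Q s"
proof -
  have "wp L 30 locate Q s"
    unfolding locate_def block.simps
    apply (rule wp_Seq[OF assms(1)], simp, rule wp_Mul[OF assms(1)], (simp add: assms(2))+)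
    apply (rule wp_Seq[OF assms(1)], simp, rule wp_Assign[OF assms(1)], simp, simp)
    apply (rule wp_Seq[OF assms(1)], simp, rule wp_Mul[OF assms(1)], (simp add: assms(2))+)
    apply (rule wp_Seq[OF assms(1)], simp, rule wp_Assign[OF assms(1)], simp, simp)
    apply (rule wp_Seq[OF assms(1)], simp, rule wp_Mul[OF assms(1)], (simp add: assms(2))+)
    apply (rule wp_Seq[OF assms(1)], simp, rule wp_Assign[OF assms(1)], simp, simp)
    apply (rule wp_Skip[OF assms(1)])
    apply (rule post, simp_all add: cell_index_def)
    done
  then show ?thesis by (rule wp_mono) (use assms(1) k in auto)
qed

text \<open>Names in D are arbitrary numbers, so the index of an entry is not looked up. The
  surrounding loops run through all index triples, and a cell is tested only if its three names are
  the current entries.\<close>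

definition cell_check :: com where
  "cell_check = block [fetch 30 10, fetch 31 11, fetch 32 12, fetch 33 13, locate,
     Cond (And (Equal (Load (Plus (Const 3) (Reg 15))) (Reg 30))
          (And (Equal (Load (Plus (Const 3) (Reg 16))) (Reg 31))
               (Equal (Load (Plus (Const 3) (Reg 17))) (Reg 32))))
       (Cond (And (Equal (Load (Plus (Const 3) (Load (Plus (Reg 5) (Reg 36))))) (Reg 33))
                  (Not (And (Not (Equal (Reg 33) (Reg 30)))
                       (And (Not (Equal (Reg 33) (Reg 31))) (Not (Equal (Reg 33) (Reg 32)))))))
         Skip (Assign 25 (Const 1)))
       Skip]"

lemma writes_cell_check [simp]:
  "writes cell_check = {25, 30, 31, 32, 33, 34, 35, 36, 39}" "storeless cell_check"
  by (auto simp: cell_check_def fetch_def locate_def)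

definition clash :: "(nat \<Rightarrow> nat) \<Rightarrow> (nat \<Rightarrow> nat \<Rightarrow> nat) \<Rightarrow> (nat \<Rightarrow> nat) \<Rightarrow> nat \<Rightarrow>
    nat \<Rightarrow> nat \<Rightarrow> nat \<Rightarrow> nat \<Rightarrow> nat \<Rightarrow> nat \<Rightarrow> nat \<Rightarrow> nat \<Rightarrow> bool" where
  "clash name row tab d x y z w j a b c \<longleftrightarrow>
     name a = row x j \<and> name b = row y j \<and> name c = row z j \<and>
     \<not> (name (tab (cell_index d j a b c)) = row w j \<and> row w j \<in> {row x j, row y j, row z j})"

definition outcome :: "(nat \<Rightarrow> nat) \<Rightarrow> (nat \<Rightarrow> nat \<Rightarrow> nat) \<Rightarrow> (nat \<Rightarrow> nat) \<Rightarrow> nat \<Rightarrow> nat \<Rightarrow>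
    nat \<Rightarrow> nat \<Rightarrow> nat \<Rightarrow> nat \<Rightarrow> bool" where
  "outcome name row tab d m x y z w \<longleftrightarrow>
     \<not> (\<exists>j<m. \<exists>a<d. \<exists>b<d. \<exists>c<d.
        clash name row tab d x y z w j a b c)"

section \<open>Memory layout and correctness of the table test\<close>

locale layout =
  fixes L d m N :: nat
  assumes L: "2 \<le> L" and d: "d \<le> L" and m: "m \<le> L" and N: "N \<le> L"
begin

text \<open>The first address after the input: three header cells, d names, N * m entries. The table
  starts here, so the blank memory already represents the all-zero table.\<close>

definition base :: nat where "base = 3 + d + N * m"
definition cells :: nat where "cells = m * d ^ 3"

lemma cells_le: "cells \<le> L ^ 4"
  unfolding cells_def using mult_le_mono[OF m power_mono[OF d, of 3]] by (simp add: power_numeral_reduce)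

lemma le_L4: "n \<le> L \<Longrightarrow> n \<le> L ^ 4"
  using self_le_power[of L 4] L by linarith

definition set_up :: "(nat \<Rightarrow> nat) \<Rightarrow> state \<Rightarrow> bool" where
  "set_up M s \<longleftrightarrow> reg s 9 = d \<and> reg s 2 = m \<and> reg s 3 = N \<and> reg s 4 = 3 + d \<and>
     reg s 5 = base \<and> reg s 6 = cells \<and> mem s = M"

lemma set_up_framed:
  "set_up M s \<Longrightarrow> framed c s s' \<Longrightarrow> storeless c \<Longrightarrow> writes c \<inter> {2, 3, 4, 5, 6, 9} = {} \<Longrightarrow> set_up M s'"
  by (auto simp: set_up_def framed_def)

definition symbol :: "(nat \<Rightarrow> nat) \<Rightarrow> nat \<Rightarrow> nat" where "symbol M a = M (3 + a)"
definition entry :: "(nat \<Rightarrow> nat) \<Rightarrow> nat \<Rightarrow> nat \<Rightarrow> nat" where "entry M x j = M (3 + d + (m * x + j))"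
definition table :: "(nat \<Rightarrow> nat) \<Rightarrow> nat \<Rightarrow> nat" where "table M q = M (base + q)"

lemma wp_cell_check:
  assumes s: "set_up M s" and r: "reg s 10 = x" "reg s 11 = y" "reg s 12 = z" "reg s 13 = w"
    "reg s 14 = j" "reg s 15 = a" "reg s 16 = b" "reg s 17 = c" and f: "reg s 25 = of_bool h"
    and Q: "\<And>s'. reg s' 25 = of_bool (h \<or> clash (symbol M) (entry M) (table M) d x y z w j a b c) \<Longrightarrow> Q s'"
  shows "wp L 40 cell_check Q s"
proof -
  note le = le_L4[OF d] le_L4[OF m]
  have regs: "reg s 2 = m" "reg s 3 = N" "reg s 4 = 3 + d" "reg s 5 = base" "reg s 9 = d" "mem s = M"
    using s by (simp_all add: set_up_def)
  show ?thesis
    unfolding cell_check_def block.simps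
    apply (rule wp_Seq[OF L], simp, rule wp_fetch[OF L], (simp add: le regs r)+)
    apply (rule wp_Seq[OF L], simp, rule wp_fetch[OF L], (simp add: le regs r)+)
    apply (rule wp_Seq[OF L], simp, rule wp_fetch[OF L], (simp add: le regs r)+)
    apply (rule wp_Seq[OF L], simp, rule wp_fetch[OF L], (simp add: le regs r)+)
    apply (rule wp_Seq[OF L], simp, rule wp_locate[OF L], simp add: le regs)
     prefer 2 apply simp
    apply (simp add: regs r)
    subgoal premises p for s'
    proof -
      note v = p(1) p(2)[rule_format] p(3) regs r
      show ?thesis
        apply (rule wp_Seq[OF L], simp)
        apply (rule wp_Cond[OF L], simp, simp)
         apply (rule wp_Cond[OF L], simp, simp)
          apply (rule wp_Skip[OF L], rule wp_Skip[OF L], rule Q)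
          apply (simp add: clash_def f symbol_def entry_def table_def v)
         apply (rule wp_Assign[OF L], simp, rule wp_Skip[OF L], rule Q)
         apply (simp add: clash_def f symbol_def entry_def table_def v)
        apply (rule wp_Skip[OF L], rule wp_Skip[OF L], rule Q)
        apply (simp add: clash_def f symbol_def entry_def table_def v)
        apply blast
        done
    qed
  done
qed

text \<open>Each of the four nested loops puts one more bounded existential quantifier in front of
  \<open>clash\<close> and adds the nine exponents of a loop.\<close>

lemma wp_loop_c:
  assumes s: "set_up M s" and r: "reg s 10 = x" "reg s 11 = y" "reg s 12 = z" "reg s 13 = w"
    "reg s 14 = j" "reg s 15 = a" "reg s 16 = b"
    and f: "reg s 25 = of_bool h"
    and Q: "\<And>s'. reg s' 25 = of_bool (h \<or> (\<exists>c<d. clash (symbol M) (entry M) (table M) d x y z w j a b c)) \<Longrightarrow>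
      framed (For 17 9 cell_check) s s' \<Longrightarrow> Q s'"
  shows "wp L 49 (For 17 9 cell_check) Q s"
proof (rule wp_For_flags[where n = d and F = "{25}" and k = 40 and g = "\<lambda>_. h" and
    R = "\<lambda>_ c. clash (symbol M) (entry M) (table M) d x y z w j a b c"])
  fix c s' h'
  assume fl: "\<forall>f\<in>{25}. reg s' f = of_bool (h' f)" and i: "reg s' 17 = c"
    and fr: "framed (For 17 9 cell_check) s s'"
  have s': "set_up M s'" by (rule set_up_framed[OF s fr]) auto
  show "wp L 40 (cell_check) (\<lambda>s''. \<forall>f\<in>{25}. reg s'' f =
      of_bool (h' f \<or> (clash (symbol M) (entry M) (table M) d x y z w j a b c))) s'"
    by (rule wp_cell_check[where h = "h' 25", OF s']) (use fr r i fl in \<open>auto simp: framed_def\<close>)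
qed (use L d m s f Q le_L4[OF d] le_L4[OF m] in \<open>auto simp: set_up_def\<close>)

lemma wp_loop_b:
  assumes s: "set_up M s" and r: "reg s 10 = x" "reg s 11 = y" "reg s 12 = z" "reg s 13 = w"
    "reg s 14 = j" "reg s 15 = a"
    and f: "reg s 25 = of_bool h"
    and Q: "\<And>s'. reg s' 25 = of_bool (h \<or> (\<exists>b<d. \<exists>c<d. clash (symbol M) (entry M) (table M) d x y z w j a b c)) \<Longrightarrow>
      framed (For 16 9 (For 17 9 cell_check)) s s' \<Longrightarrow> Q s'"
  shows "wp L 58 (For 16 9 (For 17 9 cell_check)) Q s"
proof (rule wp_For_flags[where n = d and F = "{25}" and k = 49 and g = "\<lambda>_. h" and
    R = "\<lambda>_ b. \<exists>c<d. clash (symbol M) (entry M) (table M) d x y z w j a b c"])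
  fix b s' h'
  assume fl: "\<forall>f\<in>{25}. reg s' f = of_bool (h' f)" and i: "reg s' 16 = b"
    and fr: "framed (For 16 9 (For 17 9 cell_check)) s s'"
  have s': "set_up M s'" by (rule set_up_framed[OF s fr]) auto
  show "wp L 49 (For 17 9 cell_check) (\<lambda>s''. \<forall>f\<in>{25}. reg s'' f =
      of_bool (h' f \<or> (\<exists>c<d. clash (symbol M) (entry M) (table M) d x y z w j a b c))) s'"
    by (rule wp_loop_c[where h = "h' 25", OF s']) (use fr r i fl in \<open>auto simp: framed_def\<close>)
qed (use L d m s f Q le_L4[OF d] le_L4[OF m] in \<open>auto simp: set_up_def\<close>)

lemma wp_loop_a:
  assumes s: "set_up M s" and r: "reg s 10 = x" "reg s 11 = y" "reg s 12 = z" "reg s 13 = w"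
    "reg s 14 = j"
    and f: "reg s 25 = of_bool h"
    and Q: "\<And>s'. reg s' 25 = of_bool (h \<or> (\<exists>a<d. \<exists>b<d. \<exists>c<d. clash (symbol M) (entry M) (table M) d x y z w j a b c)) \<Longrightarrow>
      framed (For 15 9 (For 16 9 (For 17 9 cell_check))) s s' \<Longrightarrow> Q s'"
  shows "wp L 67 (For 15 9 (For 16 9 (For 17 9 cell_check))) Q s"
proof (rule wp_For_flags[where n = d and F = "{25}" and k = 58 and g = "\<lambda>_. h" and
    R = "\<lambda>_ a. \<exists>b<d. \<exists>c<d. clash (symbol M) (entry M) (table M) d x y z w j a b c"])
  fix a s' h'
  assume fl: "\<forall>f\<in>{25}. reg s' f = of_bool (h' f)" and i: "reg s' 15 = a"
    and fr: "framed (For 15 9 (For 16 9 (For 17 9 cell_check))) s s'"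
  have s': "set_up M s'" by (rule set_up_framed[OF s fr]) auto
  show "wp L 58 (For 16 9 (For 17 9 cell_check)) (\<lambda>s''. \<forall>f\<in>{25}. reg s'' f =
      of_bool (h' f \<or> (\<exists>b<d. \<exists>c<d. clash (symbol M) (entry M) (table M) d x y z w j a b c))) s'"
    by (rule wp_loop_b[where h = "h' 25", OF s']) (use fr r i fl in \<open>auto simp: framed_def\<close>)
qed (use L d m s f Q le_L4[OF d] le_L4[OF m] in \<open>auto simp: set_up_def\<close>)

lemma wp_loop_j:
  assumes s: "set_up M s" and r: "reg s 10 = x" "reg s 11 = y" "reg s 12 = z" "reg s 13 = w"
    and f: "reg s 25 = of_bool h"
    and Q: "\<And>s'. reg s' 25 = of_bool (h \<or> (\<exists>j<m. \<exists>a<d. \<exists>b<d. \<exists>c<d.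
        clash (symbol M) (entry M) (table M) d x y z w j a b c)) \<Longrightarrow>
      framed (For 14 2 (For 15 9 (For 16 9 (For 17 9 cell_check)))) s s' \<Longrightarrow> Q s'"
  shows "wp L 76 (For 14 2 (For 15 9 (For 16 9 (For 17 9 cell_check)))) Q s"
proof (rule wp_For_flags[where n = m and F = "{25}" and k = 67 and g = "\<lambda>_. h" and
    R = "\<lambda>_ j. \<exists>a<d. \<exists>b<d. \<exists>c<d. clash (symbol M) (entry M) (table M) d x y z w j a b c"])
  fix j s' h'
  assume fl: "\<forall>f\<in>{25}. reg s' f = of_bool (h' f)" and i: "reg s' 14 = j"
    and fr: "framed (For 14 2 (For 15 9 (For 16 9 (For 17 9 cell_check)))) s s'"
  have s': "set_up M s'" by (rule set_up_framed[OF s fr]) auto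
  show "wp L 67 (For 15 9 (For 16 9 (For 17 9 cell_check))) (\<lambda>s''. \<forall>f\<in>{25}. reg s'' f =
      of_bool (h' f \<or> (\<exists>a<d. \<exists>b<d. \<exists>c<d. clash (symbol M) (entry M) (table M) d x y z w j a b c))) s'"
    by (rule wp_loop_a[where h = "h' 25", OF s']) (use fr r i fl in \<open>auto simp: framed_def\<close>)
qed (use L d m s f Q le_L4[OF d] le_L4[OF m] in \<open>auto simp: set_up_def\<close>)

definition nest :: com where
  "nest = For 14 2 (For 15 9 (For 16 9 (For 17 9 cell_check)))"

lemma writes_nest [simp]:
  "writes nest = {14, 15, 16, 17, 25, 30, 31, 32, 33, 34, 35, 36, 39}" "storeless nest"
  by (auto simp: nest_def)

lemma wp_nest:
  assumes s: "set_up M s" "reg s 25 = 0" and k: "76 \<le> k"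
    and Q: "\<And>s'. reg s' 25 = of_bool (\<not> outcome (symbol M) (entry M) (table M) d m (reg s 10) (reg s 11) (reg s 12) (reg s 13)) \<Longrightarrow>
      framed nest s s' \<Longrightarrow> Q s'"
  shows "wp L k nest Q s"
proof -
  have "wp L 76 nest Q s"
    unfolding nest_def
    by (rule wp_loop_j[OF s(1) refl refl refl refl, where h = False])
      (use s(2) Q in \<open>auto simp: outcome_def nest_def\<close>)
  then show ?thesis by (rule wp_mono) (use L k in auto)
qed

text \<open>Rows are compared by index; this is comparison of rows because the list has no
  repetitions.\<close>

definition mark :: "nat \<Rightarrow> nat \<Rightarrow> com" where
  "mark x f = Cond (Equal (Reg 13) (Reg x)) Skip (Assign f (Const 1))"

lemma wp_mark:
  assumes "Q (s\<lparr>reg := (reg s)(f := if reg s 13 = reg s x then reg s f else 1)\<rparr>)" "5 \<le> k"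
  shows "wp L k (mark x f) Q s"
proof -
  have "2 ^ 3 \<le> (2 :: nat) ^ (k - 1)" using assms(2) by (intro power_increasing) simp_all
  then have "(7 :: nat) \<le> 2 ^ (k - 1)" by simp
  then show ?thesis
    unfolding mark_def using assms L by (intro wp_Cond wp_Skip wp_Assign) auto
qed

definition w_body :: com where
  "w_body = block [Assign 25 (Const 0), nest,
     Cond (Equal (Reg 25) (Const 0))
       (block [Assign 24 (Const 1), mark 10 21, mark 11 22, mark 12 23]) Skip]"

lemma writes_w_body [simp]:
  "writes w_body = {14, 15, 16, 17, 21, 22, 23, 24, 25, 30, 31, 32, 33, 34, 35, 36, 39}" "storeless w_body"
  by (auto simp: w_body_def mark_def)

text \<open>\<open>f\<close> is the number of the flag that the outcome \<open>w\<close> of \<open>x\<close>, \<open>y\<close>, \<open>z\<close> has to raise.\<close>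

definition hit :: "(nat \<Rightarrow> nat) \<Rightarrow> nat \<Rightarrow> nat \<Rightarrow> nat \<Rightarrow> nat \<Rightarrow> nat \<Rightarrow> bool" where
  "hit M f x y z w \<longleftrightarrow> outcome (symbol M) (entry M) (table M) d m x y z w \<and>
     (f = 21 \<longrightarrow> w \<noteq> x) \<and> (f = 22 \<longrightarrow> w \<noteq> y) \<and> (f = 23 \<longrightarrow> w \<noteq> z)"

lemma wp_w_body:
  assumes s: "set_up M s" and r: "reg s 10 = x" "reg s 11 = y" "reg s 12 = z" "reg s 13 = w"
    and f: "\<forall>f\<in>{21, 22, 23, 24}. reg s f = of_bool (h f)"
    and Q: "\<And>s'. \<forall>f\<in>{21, 22, 23, 24}. reg s' f = of_bool (h f \<or> hit M f x y z w) \<Longrightarrow> Q s'"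
  shows "wp L 90 w_body Q s"
  unfolding w_body_def block.simps
  apply (rule wp_Seq[OF L], simp, rule wp_Assign[OF L], simp)
  apply (rule wp_Seq[OF L], simp)
  apply (rule wp_nest[where M = M])
     apply (use s in \<open>simp add: set_up_def\<close>)
    apply simp
   apply simp
  subgoal premises p for s'
  proof -
    have v: "reg s' r = reg s r" if "r \<notin> writes nest" for r
      using p(2) that by (simp add: framed_def)
    note v = p(1) v r f[simplified]
    show ?thesis
      apply (rule wp_Seq[OF L], simp)
      apply (rule wp_Cond[OF L], simp, simp)
       apply (rule wp_Seq[OF L], simp, rule wp_Assign[OF L], simp)
       apply (rule wp_Seq[OF L], simp, rule wp_mark)
        apply (rule wp_Seq[OF L], simp, rule wp_mark)
         apply (rule wp_Seq[OF L], simp, rule wp_mark)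
          apply (rule wp_Skip[OF L])
          apply (rule wp_Skip[OF L], rule Q)
          apply (simp add: hit_def v)
         apply simp_all
      apply (rule wp_Skip[OF L])
      apply (rule wp_Skip[OF L], rule Q)
      apply (simp add: hit_def v)
      done
  qed
  done

definition triple_body :: com where
  "triple_body = block [Assign 24 (Const 0), For 13 3 w_body,
     Cond (Equal (Reg 24) (Const 0)) (Assign 20 (Const 1)) Skip]"

lemma writes_triple_body [simp]:
  "writes triple_body = insert 20 (insert 13 (writes w_body))" "storeless triple_body"
  by (auto simp: triple_body_def)

text \<open>For f = 20 no side condition of \<open>hit\<close> applies, so the flag records that the
  triple has no outcome at all.\<close>

definition raised :: "(nat \<Rightarrow> nat) \<Rightarrow> nat \<Rightarrow> nat \<Rightarrow> nat \<Rightarrow> nat \<Rightarrow> bool" where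
  "raised M f x y z \<longleftrightarrow> (if f = 20 then \<not> (\<exists>w<N. hit M f x y z w) else \<exists>w<N. hit M f x y z w)"

lemma wp_triple_body:
  assumes s: "set_up M s" and r: "reg s 10 = x" "reg s 11 = y" "reg s 12 = z"
    and f: "\<forall>f\<in>{20, 21, 22, 23}. reg s f = of_bool (h f)"
    and Q: "\<And>s'. \<forall>f\<in>{20, 21, 22, 23}. reg s' f = of_bool (h f \<or> raised M f x y z) \<Longrightarrow> Q s'"
  shows "wp L 110 triple_body Q s"
  unfolding triple_body_def block.simps
  apply (rule wp_Seq[OF L], simp, rule wp_Assign[OF L], simp)
  apply (rule wp_Seq[OF L], simp)
  apply (rule wp_For_flags[where n = N and F = "{21, 22, 23, 24}" and k = 90 and
    \<comment> \<open>Flag 24 has just been cleared for this triple, while 21 to 23 keep what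
      earlier triples raised.\<close>
    g = "\<lambda>f. f \<noteq> 24 \<and> h f" and R = "\<lambda>f w. hit M f x y z w"])
            apply (use L N s f le_L4[OF N] in \<open>auto simp: set_up_def\<close>)[8]
    apply (rule wp_w_body[where M = M])
  subgoal premises p for w s' h'
    by (rule set_up_framed[OF _ p(4)]) (use s in \<open>auto simp: set_up_def\<close>)
          apply (use r in \<open>auto simp: framed_def\<close>)[6]
   apply simp
  subgoal premises p for s'
  proof -
    have v: "reg s' r = reg s r" if "r \<notin> {24, 13} \<union> writes w_body" for r
      using p(2) that by (simp add: framed_def)
    note v = p(1)[simplified] v r f[simplified]
    show ?thesis
      apply (rule wp_Seq[OF L], simp)
      apply (rule wp_Cond[OF L], simp, simp)
       apply (rule wp_Assign[OF L], simp, rule wp_Skip[OF L], rule Q)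
       apply (simp add: raised_def hit_def v)
       apply (auto simp: hit_def v)[1]
      apply (rule wp_Skip[OF L], rule wp_Skip[OF L], rule Q)
      apply (auto simp: raised_def hit_def v)
      done
  qed
  done

lemma wp_loop_z:
  assumes s: "set_up M s" and r: "reg s 10 = x" "reg s 11 = y"
    and f: "\<forall>f\<in>{20, 21, 22, 23}. reg s f = of_bool (h f)"
    and Q: "\<And>s'. \<forall>f\<in>{20, 21, 22, 23}. reg s' f = of_bool (h f \<or> (\<exists>z<N. raised M f x y z)) \<Longrightarrow>
      framed (For 12 3 triple_body) s s' \<Longrightarrow> Q s'"
  shows "wp L 119 (For 12 3 triple_body) Q s"
proof (rule wp_For_flags[where n = N and F = "{20, 21, 22, 23}" and k = 110 and g = h and
    R = "\<lambda>f z. raised M f x y z"])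
  fix z s' h'
  assume fl: "\<forall>f\<in>{20, 21, 22, 23}. reg s' f = of_bool (h' f)" and i: "reg s' 12 = z"
    and fr: "framed (For 12 3 triple_body) s s'"
  have s': "set_up M s'" by (rule set_up_framed[OF s fr]) auto
  show "wp L 110 (triple_body) (\<lambda>s''. \<forall>f\<in>{20, 21, 22, 23}. reg s'' f =
      of_bool (h' f \<or> (raised M f x y z))) s'"
    by (rule wp_triple_body[OF s' ]) (use fr r i fl in \<open>auto simp: framed_def\<close>)
qed (use L s f Q le_L4[OF N] in \<open>auto simp: set_up_def\<close>)

lemma wp_loop_y:
  assumes s: "set_up M s" and r: "reg s 10 = x"
    and f: "\<forall>f\<in>{20, 21, 22, 23}. reg s f = of_bool (h f)"
    and Q: "\<And>s'. \<forall>f\<in>{20, 21, 22, 23}. reg s' f = of_bool (h f \<or> (\<exists>y<N. \<exists>z<N. raised M f x y z)) \<Longrightarrow>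
      framed (For 11 3 (For 12 3 triple_body)) s s' \<Longrightarrow> Q s'"
  shows "wp L 128 (For 11 3 (For 12 3 triple_body)) Q s"
proof (rule wp_For_flags[where n = N and F = "{20, 21, 22, 23}" and k = 119 and g = h and
    R = "\<lambda>f y. \<exists>z<N. raised M f x y z"])
  fix y s' h'
  assume fl: "\<forall>f\<in>{20, 21, 22, 23}. reg s' f = of_bool (h' f)" and i: "reg s' 11 = y"
    and fr: "framed (For 11 3 (For 12 3 triple_body)) s s'"
  have s': "set_up M s'" by (rule set_up_framed[OF s fr]) auto
  show "wp L 119 (For 12 3 triple_body) (\<lambda>s''. \<forall>f\<in>{20, 21, 22, 23}. reg s'' f =
      of_bool (h' f \<or> (\<exists>z<N. raised M f x y z))) s'"
    by (rule wp_loop_z[OF s' ]) (use fr r i fl in \<open>auto simp: framed_def\<close>)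
qed (use L s f Q le_L4[OF N] in \<open>auto simp: set_up_def\<close>)

lemma wp_loop_x:
  assumes s: "set_up M s"
    and f: "\<forall>f\<in>{20, 21, 22, 23}. reg s f = of_bool (h f)"
    and Q: "\<And>s'. \<forall>f\<in>{20, 21, 22, 23}. reg s' f = of_bool (h f \<or> (\<exists>x<N. \<exists>y<N. \<exists>z<N. raised M f x y z)) \<Longrightarrow>
      framed (For 10 3 (For 11 3 (For 12 3 triple_body))) s s' \<Longrightarrow> Q s'"
  shows "wp L 137 (For 10 3 (For 11 3 (For 12 3 triple_body))) Q s"
proof (rule wp_For_flags[where n = N and F = "{20, 21, 22, 23}" and k = 128 and g = h and
    R = "\<lambda>f x. \<exists>y<N. \<exists>z<N. raised M f x y z"])
  fix x s' h'
  assume fl: "\<forall>f\<in>{20, 21, 22, 23}. reg s' f = of_bool (h' f)" and i: "reg s' 10 = x"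
    and fr: "framed (For 10 3 (For 11 3 (For 12 3 triple_body))) s s'"
  have s': "set_up M s'" by (rule set_up_framed[OF s fr]) auto
  show "wp L 128 (For 11 3 (For 12 3 triple_body)) (\<lambda>s''. \<forall>f\<in>{20, 21, 22, 23}. reg s'' f =
      of_bool (h' f \<or> (\<exists>y<N. \<exists>z<N. raised M f x y z))) s'"
    by (rule wp_loop_y[OF s' ]) (use fr  i fl in \<open>auto simp: framed_def\<close>)
qed (use L s f Q le_L4[OF N] in \<open>auto simp: set_up_def\<close>)

definition check :: com where
  "check = block [Assign 20 (Const 0), Assign 21 (Const 0), Assign 22 (Const 0), Assign 23 (Const 0),
     For 10 3 (For 11 3 (For 12 3 triple_body)),
     Cond (And (Equal (Reg 20) (Const 0)) (And (Equal (Reg 21) (Const 1))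
          (And (Equal (Reg 22) (Const 1)) (Equal (Reg 23) (Const 1)))))
       (Assign 7 (Const 1)) Skip]"

lemma writes_check [simp]:
  "writes check = {7, 20, 10, 11, 12, 13} \<union> writes w_body" "storeless check"
  by (auto simp: check_def)

text \<open>Flag 20 down makes the table a supportive aggregator; flags 21 to 23 up exclude the
  three possible dictators.\<close>

definition good :: "(nat \<Rightarrow> nat) \<Rightarrow> bool" where
  "good M \<longleftrightarrow> (\<forall>f\<in>{20, 21, 22, 23}. (\<exists>x<N. \<exists>y<N. \<exists>z<N. raised M f x y z) = (f \<noteq> 20))"

lemma wp_check:
  assumes s: "set_up M s" and f: "reg s 7 = of_bool h" and k: "150 \<le> k"
    and Q: "\<And>s'. reg s' 7 = of_bool (h \<or> good M) \<Longrightarrow> framed check s s' \<Longrightarrow> Q s'"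
  shows "wp L k check Q s"
proof -
  have "wp L 150 check (\<lambda>s'. reg s' 7 = of_bool (h \<or> good M)) s"
    unfolding check_def block.simps
    apply (rule wp_Seq[OF L], simp, rule wp_Assign[OF L], simp)
    apply (rule wp_Seq[OF L], simp, rule wp_Assign[OF L], simp)
    apply (rule wp_Seq[OF L], simp, rule wp_Assign[OF L], simp)
    apply (rule wp_Seq[OF L], simp, rule wp_Assign[OF L], simp)
    apply (rule wp_Seq[OF L], simp, rule wp_mono[where k = 137])
       apply (rule wp_loop_x[where M = M and h = "\<lambda>_. False"])
         apply (use s in \<open>simp add: set_up_def\<close>)
        apply simp
       apply (erule conjI, assumption)
      apply (use L in simp)
     apply simp
    apply (erule conjE)
    subgoal premises p for s'
    proof -
      have v: "reg s' 7 = of_bool h" using p(2) f by (simp add: framed_def)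
      show ?thesis
        apply (rule wp_Seq[OF L], simp)
        apply (rule wp_Cond[OF L], simp, simp)
         apply (rule wp_Assign[OF L], simp, rule wp_Skip[OF L])
         apply (use p(1) in \<open>auto simp: good_def\<close>)[1]
        apply (rule wp_Skip[OF L], rule wp_Skip[OF L])
        apply (use p(1) v in \<open>auto simp: good_def\<close>)[1]
        done
    qed
    done
  from wp_framed[OF this] show ?thesis by (rule wp_mono) (use L k Q in auto)
qed

section \<open>Counting through the tables in base d\<close>

definition step_body :: com where
  "step_body = Cond (Equal (Reg 26) (Const 1))
     (block [Store (Plus (Reg 5) (Reg 40)) (Plus (Load (Plus (Reg 5) (Reg 40))) (Const 1)),
        Cond (Equal (Load (Plus (Reg 5) (Reg 40))) (Reg 9))
          (Store (Plus (Reg 5) (Reg 40)) (Const 0)) (Assign 26 (Const 0))]) Skip"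

lemma writes_step_body [simp]: "writes step_body = {26}"
  by (auto simp: step_body_def)

definition increment :: com where
  "increment = block [Assign 26 (Const 1), For 40 6 step_body, Assign 8 (Reg 26)]"

lemma writes_increment [simp]: "writes increment = {26, 40, 8}"
  by (auto simp: increment_def)

definition layer :: "(nat \<Rightarrow> nat) \<Rightarrow> nat \<Rightarrow> nat \<Rightarrow> nat" where
  "layer M v a = (if a < base then M a else if a < base + cells then v div d ^ (a - base) mod d else 0)"

text \<open>The memory after the \<open>i\<close> lowest digits of the counter \<open>v\<close> have been updated to those of \<open>v + 1\<close>.\<close>

definition mixed :: "(nat \<Rightarrow> nat) \<Rightarrow> nat \<Rightarrow> nat \<Rightarrow> nat \<Rightarrow> nat" where
  "mixed M v i a = layer M (if a < base + i then Suc v else v) a"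

lemma mixed_0: "mixed M v 0 = layer M v"
  by (auto simp: mixed_def layer_def)

lemma mixed_cells: "mixed M v cells = layer M (Suc v)"
  by (auto simp: mixed_def layer_def)

text \<open>In passing from v to v + 1 a carry reaches digit i exactly if all lower digits of v are
  d - 1, that is, if \<open>d ^ i\<close> divides \<open>Suc v\<close>. This gives the carry flag a
  closed form.\<close>

lemma wp_step_body:
  assumes s: "reg s 5 = base" "reg s 9 = d" "reg s 40 = i" "mem s = mixed M v i"
    "reg s 26 = of_bool (d ^ i dvd Suc v)" and i: "i < cells"
    and Q: "\<And>s'. mem s' = mixed M v (Suc i) \<Longrightarrow> reg s' 26 = of_bool (d ^ Suc i dvd Suc v) \<Longrightarrow> Q s'"
  shows "wp L 10 step_body Q s"
proof -
  have "d \<noteq> 0" using i unfolding cells_def by (cases "d = 0") auto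
  have cell: "mixed M v i (base + i) = v div d ^ i mod d"
    using i by (simp add: mixed_def layer_def)
  have next_mem: "mixed M v (Suc i) = (mixed M v i)(base + i := Suc v div d ^ i mod d)"
    using i by (auto simp: mixed_def layer_def fun_eq_iff)
  have dvd: "d * d ^ i dvd Suc v \<longleftrightarrow> d ^ i dvd Suc v \<and> Suc v div d ^ i mod d = 0"
  proof -
    have "d ^ Suc i dvd Suc v \<longleftrightarrow> d dvd Suc v div d ^ i" if "d ^ i dvd Suc v"
      using that \<open>d \<noteq> 0\<close> by (auto elim!: dvdE simp: mult.commute)
    then show ?thesis by (metis dvd_mult_right power_Suc dvd_eq_mod_eq_0)
  qed
  show ?thesis
  proof (cases "d ^ i dvd Suc v")
    case True
    have div: "Suc v div d ^ i = Suc (v div d ^ i)" using True by (simp add: div_Suc dvd_eq_mod_eq_0)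
    have md: "Suc (v div d ^ i) mod d = (if Suc (v div d ^ i mod d) = d then 0 else Suc (v div d ^ i mod d))"
      by (simp add: mod_Suc)
    show ?thesis
      unfolding step_body_def block.simps
      apply (rule wp_Cond[OF L], simp, simp)
       apply (rule wp_Seq[OF L], simp, rule wp_Store[OF L], simp)
       apply (rule wp_Seq[OF L], simp, rule wp_Cond[OF L], simp, simp)
         apply (rule wp_Store[OF L], simp, rule wp_Skip[OF L], rule Q)
          apply (simp add: next_mem s cell div md flip: Suc_eq_plus1)
         apply (simp add: next_mem s cell div md dvd True flip: Suc_eq_plus1)
        apply (rule wp_Assign[OF L], simp, rule wp_Skip[OF L], rule Q)
         apply (simp add: next_mem s cell div md flip: Suc_eq_plus1)
        apply (simp add: next_mem s cell div md dvd True flip: Suc_eq_plus1)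
      apply (use s True in simp)
      done
  next
    case False
    have div: "Suc v div d ^ i = v div d ^ i" using False by (simp add: div_Suc dvd_eq_mod_eq_0)
    show ?thesis
      unfolding step_body_def block.simps
      apply (rule wp_Cond[OF L], simp, simp)
       apply (use s False in simp)
      apply (rule wp_Skip[OF L], rule Q)
       apply (simp add: next_mem s div flip: cell)
      apply (simp add: s dvd False)
      done
  qed
qed

lemma wp_increment:
  assumes s: "set_up (layer M v) s" and v: "v < d ^ cells" and k: "25 \<le> k"
    and Q: "\<And>s'. set_up (layer M (Suc v)) s' \<Longrightarrow> reg s' 8 = of_bool (Suc v = d ^ cells) \<Longrightarrow>
      framed increment s s' \<Longrightarrow> Q s'"
  shows "wp L k increment Q s"
proof -
  \<comment> \<open>As v is below \<open>d ^ cells\<close>, a carry out of the last digit occurs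
    only after the last table.\<close>
  have full: "d ^ cells dvd Suc v \<longleftrightarrow> Suc v = d ^ cells"
    using v by (auto dest: dvd_imp_le)
  let ?I = "\<lambda>i s'. mem s' = mixed M v i \<and> reg s' 26 = of_bool (d ^ i dvd Suc v)"
  have regs: "reg s 2 = m" "reg s 3 = N" "reg s 4 = 3 + d" "reg s 5 = base" "reg s 6 = cells" "reg s 9 = d"
    "mem s = layer M v" using s by (simp_all add: set_up_def)
  have "wp L 25 increment (\<lambda>s'. mem s' = layer M (Suc v) \<and> reg s' 8 = of_bool (Suc v = d ^ cells)) s"
    unfolding increment_def block.simps
    apply (rule wp_Seq[OF L], simp, rule wp_Assign[OF L], simp)
    apply (rule wp_Seq[OF L], simp, rule wp_mono[OF wp_For[where I = ?I and k = 10]])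
              apply (use L cells_le in \<open>simp_all add: regs mixed_0\<close>)[6]
      subgoal for i s' by (rule wp_step_body) (auto simp: framed_def regs)
     apply (use L in simp_all)[2]
    apply (rule wp_Seq[OF L], simp, rule wp_Assign[OF L], simp)
    apply (rule wp_Skip[OF L])
    apply (simp add: regs mixed_cells full)
    done
  from wp_framed[OF this] show ?thesis
    by (rule wp_mono) (use L k in \<open>auto intro!: Q simp: set_up_def regs framed_def\<close>)
qed

definition table_loop :: com where
  "table_loop = While (Equal (Reg 8) (Const 0)) (Seq check increment)"

text \<open>The number of rounds is not bounded by a power of L, so the time is stated explicitly
  instead of through \<open>wp\<close>: each remaining table costs one body and one test of 4
  steps.\<close>

lemma exec_table_loop:
  assumes "set_up (layer M v) s" "v < d ^ cells" "reg s 8 = 0"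
    and "reg s 7 = of_bool (\<exists>v'<v. good (layer M v'))"
  shows "\<exists>t s'. exec table_loop s t s' \<and> t \<le> (d ^ cells - v) * (L ^ 151 + 4) + 4 \<and>
    reg s' 7 = of_bool (\<exists>v'<d ^ cells. good (layer M v'))"
  using assms
proof (induction "d ^ cells - v" arbitrary: v s rule: less_induct)
  case less
  have "wp L 151 (Seq check increment) (\<lambda>s'. set_up (layer M (Suc v)) s' \<and>
      reg s' 8 = of_bool (Suc v = d ^ cells) \<and> reg s' 7 = of_bool (\<exists>v'<Suc v. good (layer M v'))) s"
    apply (rule wp_Seq[OF L], simp)
    apply (rule wp_check[OF less.prems(1,4)], simp)
    subgoal for s1
      apply (rule wp_increment[OF set_up_framed[OF less.prems(1)] less.prems(2)], assumption)
         apply (auto simp: framed_def less_Suc_eq)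
      done
    done
  then obtain t s1 where s1: "exec (Seq check increment) s t s1" "t \<le> L ^ 151" "set_up (layer M (Suc v)) s1"
      "reg s1 8 = of_bool (Suc v = d ^ cells)" "reg s1 7 = of_bool (\<exists>v'<Suc v. good (layer M v'))"
    unfolding wp_def by blast
  have "\<exists>t' s'. exec table_loop s1 t' s' \<and> t' \<le> (d ^ cells - Suc v) * (L ^ 151 + 4) + 4 \<and>
      reg s' 7 = of_bool (\<exists>v'<d ^ cells. good (layer M v'))"
  proof (cases "Suc v = d ^ cells")
    case True
    have "exec table_loop s1 (1 + bcost (Equal (Reg 8) (Const 0))) s1"
      unfolding table_loop_def using s1(4) True by (intro exec_WhileF) simp
    moreover have "1 + bcost (Equal (Reg 8) (Const 0)) \<le> (d ^ cells - Suc v) * (L ^ 151 + 4) + 4" by simp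
    ultimately show ?thesis using s1(5) True by metis
  next
    case False
    then show ?thesis using less.hyps[of "Suc v" s1] less.prems(2) s1 by auto
  qed
  then obtain t' s' where s': "exec table_loop s1 t' s'" "t' \<le> (d ^ cells - Suc v) * (L ^ 151 + 4) + 4"
      "reg s' 7 = of_bool (\<exists>v'<d ^ cells. good (layer M v'))" by blast
  have "exec table_loop s (1 + bcost (Equal (Reg 8) (Const 0)) + t + t') s'"
    unfolding table_loop_def using less.prems(3) s1(1) s'(1)[unfolded table_loop_def]
    by (intro exec_WhileT) auto
  moreover have "1 + bcost (Equal (Reg 8) (Const 0)) + t + t' \<le> (d ^ cells - v) * (L ^ 151 + 4) + 4"
  proof -
    have "d ^ cells - v = Suc (d ^ cells - Suc v)" using less.prems(2) by simp
    then show ?thesis using s1(2) s'(2) by simp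
  qed
  ultimately show ?case using s'(3) by blast
qed

section \<open>Preparation of the registers and total running time\<close>

definition prologue :: com where
  "prologue = block [Assign 9 (Load (Const 0)), Assign 2 (Load (Const 1)), Assign 3 (Load (Const 2)),
     Assign 4 (Plus (Const 3) (Reg 9)), Mul 39 5 3 2, Assign 5 (Plus (Reg 5) (Reg 4)),
     Mul 39 30 9 9, Mul 39 31 9 30, Mul 39 6 2 31]"

lemma wp_prologue:
  assumes M: "mem s 0 = d" "mem s 1 = m" "mem s 2 = N"
  shows "wp L 40 prologue (\<lambda>s'. set_up (mem s) s' \<and> framed prologue s s') s"
proof -
  note le = le_L4[OF d] le_L4[OF m] le_L4[OF N]
  have "wp L 40 prologue (set_up (mem s)) s"
    unfolding prologue_def block.simps
    apply (rule wp_Seq[OF L], simp, rule wp_Assign[OF L], simp add: M, simp add: M)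
    apply (rule wp_Seq[OF L], simp, rule wp_Assign[OF L], simp add: M, simp add: M)
    apply (rule wp_Seq[OF L], simp, rule wp_Assign[OF L], simp add: M, simp add: M)
    apply (rule wp_Seq[OF L], simp, rule wp_Assign[OF L], simp, simp)
    apply (rule wp_Seq[OF L], simp, rule wp_Mul[OF L], (simp add: le)+)
    apply (rule wp_Seq[OF L], simp, rule wp_Assign[OF L], simp, simp)
    apply (rule wp_Seq[OF L], simp, rule wp_Mul[OF L], (simp add: le)+)
    apply (rule wp_Seq[OF L], simp, rule wp_Mul[OF L], (simp add: le)+)
    apply (rule wp_Seq[OF L], simp, rule wp_Mul[OF L], (simp add: le)+)
    apply (rule wp_Skip[OF L])
    apply (simp add: set_up_def base_def cells_def power3_eq_cube mult.assoc add.commute)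
    done
  then show ?thesis by (rule wp_framed)
qed

definition decide :: com where
  "decide = Seq prologue (Seq table_loop (Assign 0 (Minus (Const 1) (Reg 7))))"

lemma exec_decide:
  assumes M: "M 0 = d" "M 1 = m" "M 2 = N" "\<And>a. base \<le> a \<Longrightarrow> M a = 0"
  shows "\<exists>t s'. exec decide \<lparr>reg = \<lambda>_. 0, mem = M\<rparr> t s' \<and> t \<le> L ^ 160 * d ^ cells \<and>
    reg s' 0 = of_bool (\<not> (\<exists>v<d ^ cells. good (layer M v)))"
proof -
  let ?s = "\<lparr>reg = \<lambda>_. 0, mem = M\<rparr>"
  obtain t1 s1 where s1: "exec prologue ?s t1 s1" "t1 \<le> L ^ 40" "set_up M s1" "framed prologue ?s s1"
    using wp_prologue[of ?s] M unfolding wp_def by auto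
  have layer0: "layer M 0 = M" using M(4) by (auto simp: layer_def fun_eq_iff)
  \<comment> \<open>For d = 0 there are no cells, and the single empty table remains.\<close>
  have D: "0 < d ^ cells" unfolding cells_def by (cases "d = 0") auto
  have "reg s1 7 = 0" "reg s1 8 = 0" using s1(4) by (auto simp: framed_def prologue_def)
  then obtain t2 s2 where s2: "exec table_loop s1 t2 s2" "t2 \<le> d ^ cells * (L ^ 151 + 4) + 4"
      "reg s2 7 = of_bool (\<exists>v<d ^ cells. good (layer M v))"
    using exec_table_loop[of M 0 s1] s1(3) D by (auto simp: layer0)
  obtain s3 where s3: "exec (Assign 0 (Minus (Const 1) (Reg 7))) s2 4 s3"
      "reg s3 0 = of_bool (\<not> (\<exists>v<d ^ cells. good (layer M v)))"
    using exec_Assign[of 0 "Minus (Const 1) (Reg 7)" s2] s2(3) by (fastforce simp: eval_nat_numeral One_nat_def)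
  have "exec decide ?s (t1 + (t2 + 4)) s3"
    unfolding decide_def by (intro exec_Seq[OF s1(1)] exec_Seq[OF s2(1)] s3(1))
  \<comment> \<open>Everything outside the rounds is at most 9 * L^151, a round at most 5 * L^151.
    The resulting factor 14 is below 2^9, which raises the exponent from 151 to 160.\<close>
  moreover have "t1 + (t2 + 4) \<le> L ^ 160 * d ^ cells"
  proof -
    let ?A = "L ^ 151"
    have A: "L ^ 40 \<le> ?A" "1 \<le> ?A" using L by (auto intro: power_increasing)
    have "d ^ cells * (?A + 4) \<le> d ^ cells * (5 * ?A)" using A(2) by (intro mult_le_mono2) linarith
    then have "t1 + (t2 + 4) \<le> d ^ cells * (5 * ?A) + 9 * ?A" using s1(2) s2(2) A by linarith
    also have "\<dots> \<le> d ^ cells * (5 * ?A) + d ^ cells * (9 * ?A)"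
      using mult_le_mono1[of 1 "d ^ cells" "9 * ?A"] D by linarith
    also have "\<dots> = 14 * (?A * d ^ cells)" by (simp add: algebra_simps)
    also have "\<dots> \<le> L ^ 9 * (?A * d ^ cells)" using power_mono[OF L, of 9] by (intro mult_le_mono1) simp
    also have "\<dots> = L ^ 160 * d ^ cells" by (simp add: mult.assoc[symmetric] power_add[symmetric])
    finally show ?thesis .
  qed
  ultimately show ?thesis using s3(2) by blast
qed

end

section \<open>Tables and ternary aggregators\<close>

declare One_nat_def [simp]

section \<open>Digit expansions and addresses\<close>

lemma ex_digits:
  fixes T :: "nat \<Rightarrow> nat"
  assumes "\<And>q. q < n \<Longrightarrow> T q < d"
  shows "\<exists>v<d ^ n. \<forall>q<n. v div d ^ q mod d = T q"
  using assms
proof (induction n arbitrary: T)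
  case (Suc n)
  obtain v where v: "v < d ^ n" "\<forall>q<n. v div d ^ q mod d = T (Suc q)"
    using Suc.IH[of "\<lambda>q. T (Suc q)"] Suc.prems by auto
  have T0: "T 0 < d" using Suc.prems by blast
  have "(T 0 + d * v) div d ^ q mod d = T q" if "q < Suc n" for q
  proof (cases q)
    case (Suc q')
    have "(T 0 + d * v) div d = v" using T0 by simp
    then show ?thesis using v(2) that Suc by (simp add: div_mult2_eq)
  qed (use T0 in simp)
  moreover have "T 0 + d * v < d ^ Suc n"
  proof -
    have "T 0 + d * v < d + d * v" using T0 by simp
    also have "\<dots> = d * Suc v" by simp
    also have "\<dots> \<le> d * d ^ n" using v(1) by (intro mult_le_mono2) simp
    finally show ?thesis by simp
  qed
  ultimately show ?case by blast
qed simp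

lemma nth_concat_uniform:
  "\<forall>x\<in>set xs. length x = m \<Longrightarrow> i < length xs \<Longrightarrow> j < m \<Longrightarrow> concat xs ! (m * i + j) = xs ! i ! j"
proof (induction xs arbitrary: i)
  case (Cons x xs)
  then show ?case by (cases i) (auto simp: nth_append)
qed simp

lemma length_concat_uniform: "\<forall>x\<in>set xs. length x = m \<Longrightarrow> length (concat xs) = length xs * m"
  by (induction xs) auto

lemma mult_add_less: "i < n \<Longrightarrow> a < d \<Longrightarrow> d * i + a < n * (d :: nat)"
proof -
  assume "i < n" "a < d"
  then have "d * i + a < d * Suc i" by simp
  also have "\<dots> \<le> d * n" using \<open>i < n\<close> by (intro mult_le_mono2) simp
  finally show ?thesis by (simp add: mult.commute)
qed

lemma cell_index_less: "j < m \<Longrightarrow> a < d \<Longrightarrow> b < d \<Longrightarrow> c < d \<Longrightarrow> cell_index d j a b c < m * d ^ 3"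
  using mult_add_less[of "d * (d * j + a) + b" "m * d * d" c d] mult_add_less[of "d * j + a" "m * d" b d]
    mult_add_less[of j m a d]
  by (simp add: cell_index_def power3_eq_cube mult.assoc)

lemma cell_index_decode:
  assumes "a < d" "b < d" "c < d"
  shows "cell_index d j a b c mod d = c" "cell_index d j a b c div d mod d = b"
    "cell_index d j a b c div d div d mod d = a" "cell_index d j a b c div d div d div d = j"
  using assms by (simp_all add: cell_index_def)

locale instance_data =
  fixes ds :: "nat list" and m :: nat and xs :: "nat list list"
  assumes distinct_ds: "distinct ds" and distinct_xs: "distinct xs"
    and rows: "set xs \<subseteq> tuples (set ds) m"
begin

abbreviation "d \<equiv> length ds"
abbreviation "N \<equiv> length xs"
abbreviation "X \<equiv> set xs"

text \<open>This sum dominates all three sizes, is at least 2 even on empty input, and is linear, so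
  its powers are polynomials in the sizes.\<close>

sublocale layout "2 + N + m + d" d m N
  by unfold_locales auto

definition tape :: "nat \<Rightarrow> nat" where
  "tape i = (if i < length (encode ds m xs) then encode ds m xs ! i else 0)"

lemma length_row: "x \<in> X \<Longrightarrow> length x = m"
  using rows by (auto simp: tuples_def)

lemma entry_mem: "x < N \<Longrightarrow> j < m \<Longrightarrow> xs ! x ! j \<in> set ds"
  using rows by (metis nth_mem nth_mem_tuples subsetD)

lemma length_encode: "length (encode ds m xs) = base"
proof -
  have "length (concat xs) = N * m"
    using length_row by (intro length_concat_uniform) blast
  then show ?thesis by (simp add: encode_def base_def)
qed

lemma tape_header: "tape 0 = d" "tape 1 = m" "tape 2 = N"
  by (simp_all add: tape_def encode_def eval_nat_numeral One_nat_def)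

lemma tape_blank: "base \<le> a \<Longrightarrow> tape a = 0"
  by (simp add: tape_def length_encode)

lemma encode_nth: "a < base - 3 \<Longrightarrow> encode ds m xs ! (3 + a) = (ds @ concat xs) ! a"
  by (simp add: encode_def eval_nat_numeral)

definition digit :: "nat \<Rightarrow> nat \<Rightarrow> nat" where
  "digit v q = v div d ^ q mod d"

lemma symbol_layer: "a < d \<Longrightarrow> symbol (layer tape v) a = ds ! a"
  using encode_nth[of a] by (simp add: symbol_def layer_def tape_def length_encode base_def nth_append)

lemma entry_layer:
  assumes "x < N" "j < m"
  shows "entry (layer tape v) x j = xs ! x ! j"
proof -
  have "m * x + j < N * m" using mult_add_less assms by blast
  then show ?thesis
    using encode_nth[of "d + (m * x + j)"] nth_concat_uniform[of xs m x j] assms length_row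
    by (simp add: entry_def layer_def tape_def length_encode base_def nth_append add.assoc)
qed

lemma table_layer: "q < cells \<Longrightarrow> table (layer tape v) q = digit v q"
  by (simp add: table_def layer_def digit_def)

definition index :: "nat \<Rightarrow> nat" where
  "index a = (THE i. i < d \<and> ds ! i = a)"

lemma index_nth: "i < d \<Longrightarrow> index (ds ! i) = i"
  unfolding index_def using distinct_ds by (auto simp: nth_eq_iff_index_eq)

lemma index_mem: "a \<in> set ds \<Longrightarrow> index a < d \<and> ds ! index a = a"
  using index_nth by (metis in_set_conv_nth)

definition read_table :: "(nat \<Rightarrow> nat) \<Rightarrow> nat \<Rightarrow> nat list \<Rightarrow> nat" where
  "read_table T j u = ds ! T (cell_index d j (index (u ! 0)) (index (u ! 1)) (index (u ! 2)))"

definition agrees :: "(nat \<Rightarrow> nat list \<Rightarrow> nat) \<Rightarrow> nat \<Rightarrow> nat \<Rightarrow> nat \<Rightarrow> nat \<Rightarrow> bool" where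
  "agrees f x y z w \<longleftrightarrow> (\<forall>j<m. f j [xs ! x ! j, xs ! y ! j, xs ! z ! j] = xs ! w ! j \<and>
     xs ! w ! j \<in> {xs ! x ! j, xs ! y ! j, xs ! z ! j})"

lemma outcome_layer:
  assumes "v < d ^ cells" "x < N" "y < N" "z < N" "w < N"
  shows "outcome (symbol (layer tape v)) (entry (layer tape v)) (table (layer tape v)) d m x y z w \<longleftrightarrow>
    agrees (read_table (digit v)) x y z w"
proof -
  have "(\<exists>a<d. \<exists>b<d. \<exists>c<d. clash (symbol (layer tape v)) (entry (layer tape v)) (table (layer tape v)) d x y z w j a b c) \<longleftrightarrow>
      \<not> (read_table (digit v) j [xs ! x ! j, xs ! y ! j, xs ! z ! j] = xs ! w ! j \<and>
     xs ! w ! j \<in> {xs ! x ! j, xs ! y ! j, xs ! z ! j})" (is "?l \<longleftrightarrow> \<not> ?r")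
    if j: "j < m" for j
  proof -
    let ?a = "index (xs ! x ! j)" and ?b = "index (xs ! y ! j)" and ?c = "index (xs ! z ! j)"
    have abc: "?a < d" "?b < d" "?c < d" "ds ! ?a = xs ! x ! j" "ds ! ?b = xs ! y ! j" "ds ! ?c = xs ! z ! j"
      using index_mem entry_mem assms j by blast+
    \<comment> \<open>Since the names are distinct, exactly one index triple matches the three
      entries, and the quantifiers over a, b, c collapse to that cell.\<close>
    have cl: "clash (symbol (layer tape v)) (entry (layer tape v)) (table (layer tape v)) d x y z w j a b c \<longleftrightarrow>
        a = ?a \<and> b = ?b \<and> c = ?c \<and> \<not> ?r" if "a < d" "b < d" "c < d" for a b c
    proof -
      have p: "cell_index d j a b c < cells" using cell_index_less j that by (simp add: cells_def)
      have "d \<noteq> 0" using that by auto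
      then have dg: "digit v (cell_index d j a b c) < d" by (simp add: digit_def)
      have "ds ! a = xs ! x ! j \<longleftrightarrow> a = ?a" "ds ! b = xs ! y ! j \<longleftrightarrow> b = ?b" "ds ! c = xs ! z ! j \<longleftrightarrow> c = ?c"
        using index_nth that abc by metis+
      then show ?thesis
        using that assms(2-5) j p dg
        by (auto simp: clash_def symbol_layer entry_layer table_layer read_table_def eval_nat_numeral One_nat_def)
    qed
    show ?thesis using cl abc(1-3) by blast
  qed
  then show ?thesis unfolding outcome_def agrees_def by blast
qed

section \<open>Ternary aggregators in terms of rows\<close>

definition valid :: "(nat \<Rightarrow> nat list \<Rightarrow> nat) \<Rightarrow> bool" where
  "valid f \<longleftrightarrow> (\<forall>x<N. \<forall>y<N. \<forall>z<N. \<exists>w<N. agrees f x y z w) \<and>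
     (\<exists>x<N. \<exists>y<N. \<exists>z<N. \<exists>w<N. agrees f x y z w \<and> w \<noteq> x) \<and>
     (\<exists>x<N. \<exists>y<N. \<exists>z<N. \<exists>w<N. agrees f x y z w \<and> w \<noteq> y) \<and>
     (\<exists>x<N. \<exists>y<N. \<exists>z<N. \<exists>w<N. agrees f x y z w \<and> w \<noteq> z)"

lemma good_layer:
  assumes "v < d ^ cells"
  shows "good (layer tape v) \<longleftrightarrow> valid (read_table (digit v))"
proof -
  note o = outcome_layer[OF assms]
  show ?thesis
    unfolding good_def raised_def hit_def valid_def
    using o by (simp cong: conj_cong)
qed

lemma triple_tuple: "u \<in> tuples A 3 \<longleftrightarrow> (\<exists>a\<in>A. \<exists>b\<in>A. \<exists>c\<in>A. u = [a, b, c])"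
  by (auto simp: tuples_def length_Suc_conv eval_nat_numeral)

lemma triple_in_tuples: "a \<in> A \<Longrightarrow> b \<in> A \<Longrightarrow> c \<in> A \<Longrightarrow> [a, b, c] \<in> tuples A 3"
  by (auto simp: triple_tuple)

lemma coord_rows: "a \<in> coord X j \<longleftrightarrow> (\<exists>x<N. a = xs ! x ! j)"
  by (auto simp: coord_def in_set_conv_nth)

lemma entry_coord: "x < N \<Longrightarrow> xs ! x ! j \<in> coord X j"
  by (auto simp: coord_rows)

text \<open>Any three values in D_j come from three rows, so outcomes of row triples determine f on
  all of D_j^3. Under a dictator every outcome would equal the dictator's row entry by entry, hence
  have the same index; conversely, a deviation at one coordinate extends to rows whose outcome
  differs from that voter's row.\<close>

lemma valid_iff: "valid f \<longleftrightarrow> nondictatorial_aggregator m X 3 f"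
proof
  assume v: "valid f"
  have ex: "\<exists>w<N. agrees f x y z w" if "x < N" "y < N" "z < N" for x y z
    using v that by (simp add: valid_def)
  have sup: "supportive m X 3 f"
    unfolding supportive_def
  proof (intro allI ballI impI)
    fix j u assume j: "j < m" and "u \<in> tuples (coord X j) 3"
    then obtain x y z where "x < N" "y < N" "z < N" and u: "u = [xs ! x ! j, xs ! y ! j, xs ! z ! j]"
      by (auto simp: triple_tuple coord_rows)
    with ex obtain w where "agrees f x y z w" by blast
    then show "f j u \<in> set u" using j unfolding agrees_def u by auto
  qed
  have iia: "iia_aggregator m X 3 f"
  proof (rule iia_aggregatorI[OF sup])
    fix P assume "P \<in> tuples X 3"
    then obtain x y z where "x < N" "y < N" "z < N" and P: "P = [xs ! x, xs ! y, xs ! z]"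
      unfolding triple_tuple by (metis in_set_conv_nth)
    with ex obtain w where w: "w < N" "agrees f x y z w" by blast
    have "map (\<lambda>j. f j (map (\<lambda>x. x ! j) P)) [0..<m] = xs ! w"
      using w length_row[of "xs ! w"] by (intro nth_equalityI) (auto simp: agrees_def P)
    then show "map (\<lambda>j. f j (map (\<lambda>x. x ! j) P)) [0..<m] \<in> X" using w(1) by simp
  qed
  have "\<not> dictatorship m X 3 f"
  proof
    assume "dictatorship m X 3 f"
    then obtain k where k: "k < 3" "\<And>j u. j < m \<Longrightarrow> u \<in> tuples (coord X j) 3 \<Longrightarrow> f j u = u ! k"
      unfolding dictatorship_def by blast
    obtain x y z w where r: "x < N" "y < N" "z < N" "w < N" "agrees f x y z w" "w \<noteq> [x, y, z] ! k"
    proof -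
      consider "k = 0" | "k = 1" | "k = 2" using k(1) by linarith
      then show thesis by cases (use v that in \<open>auto simp: valid_def eval_nat_numeral One_nat_def\<close>)
    qed
    define t where "t = [x, y, z] ! k"
    have t: "t < N" "w \<noteq> t" using r k(1) by (auto simp: t_def less_Suc_eq eval_nat_numeral)
    have "xs ! w ! j = xs ! t ! j" if j: "j < m" for j
    proof -
      have "[xs ! x ! j, xs ! y ! j, xs ! z ! j] \<in> tuples (coord X j) 3"
        using r by (intro triple_in_tuples entry_coord)
      from k(2)[OF j this] have "xs ! w ! j = map (\<lambda>i. xs ! i ! j) [x, y, z] ! k"
        using r(5) j by (simp add: agrees_def)
      also have "\<dots> = xs ! t ! j" using k(1) unfolding t_def by (subst nth_map) auto
      finally show ?thesis .
    qed
    then have "xs ! w = xs ! t" using length_row r(4) t(1) by (intro nth_equalityI) auto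
    then show False using distinct_xs r(4) t by (simp add: nth_eq_iff_index_eq)
  qed
  with iia sup show "nondictatorial_aggregator m X 3 f" by (simp add: nondictatorial_aggregator_def)
next
  assume "nondictatorial_aggregator m X 3 f"
  then have iia: "iia_aggregator m X 3 f" and sup: "supportive m X 3 f" and nd: "\<not> dictatorship m X 3 f"
    by (simp_all add: nondictatorial_aggregator_def)
  have ex: "\<exists>w<N. agrees f x y z w" if xyz: "x < N" "y < N" "z < N" for x y z
  proof -
    have "map (\<lambda>j. f j (map (\<lambda>x. x ! j) [xs ! x, xs ! y, xs ! z])) [0..<m] \<in> X"
      using xyz by (intro iia_aggregatorD[OF iia]) (auto simp: triple_tuple)
    then obtain w where w: "w < N" "xs ! w = map (\<lambda>j. f j [xs ! x ! j, xs ! y ! j, xs ! z ! j]) [0..<m]"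
      by (auto simp: in_set_conv_nth)
    have "f j [xs ! x ! j, xs ! y ! j, xs ! z ! j] \<in> {xs ! x ! j, xs ! y ! j, xs ! z ! j}" if "j < m" for j
    proof -
      have "[xs ! x ! j, xs ! y ! j, xs ! z ! j] \<in> tuples (coord X j) 3"
        using xyz by (intro triple_in_tuples entry_coord)
      then show ?thesis using sup that unfolding supportive_def by fastforce
    qed
    then have "agrees f x y z w" using w by (simp add: agrees_def)
    with w(1) show ?thesis by blast
  qed
  have dev: "\<exists>x<N. \<exists>y<N. \<exists>z<N. \<exists>w<N. agrees f x y z w \<and> w \<noteq> [x, y, z] ! k" if k: "k < 3" for k
  proof -
    obtain j u where j: "j < m" "u \<in> tuples (coord X j) 3" "f j u \<noteq> u ! k"
      using nd k unfolding dictatorship_def by blast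
    then obtain x y z where xyz: "x < N" "y < N" "z < N" and u: "u = [xs ! x ! j, xs ! y ! j, xs ! z ! j]"
      by (auto simp: triple_tuple coord_rows)
    with ex obtain w where w: "w < N" "agrees f x y z w" by blast
    have "u ! k = map (\<lambda>i. xs ! i ! j) [x, y, z] ! k" by (simp add: u)
    also have "\<dots> = xs ! ([x, y, z] ! k) ! j" using k by (subst nth_map) auto
    finally have "w \<noteq> [x, y, z] ! k" using j w(2) by (auto simp: agrees_def u)
    with xyz w show ?thesis by blast
  qed
  show "valid f"
    unfolding valid_def using ex dev[of 0] dev[of 1] dev[of 2]
    by (simp add: eval_nat_numeral One_nat_def)
qed

lemma valid_cong:
  assumes "\<And>j x y z. j < m \<Longrightarrow> x < N \<Longrightarrow> y < N \<Longrightarrow> z < N \<Longrightarrow>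
    f j [xs ! x ! j, xs ! y ! j, xs ! z ! j] = g j [xs ! x ! j, xs ! y ! j, xs ! z ! j]"
  shows "valid f \<longleftrightarrow> valid g"
proof -
  have "agrees f x y z w \<longleftrightarrow> agrees g x y z w" if "x < N" "y < N" "z < N" for x y z w
    using assms that by (simp add: agrees_def)
  then show ?thesis unfolding valid_def by (simp cong: conj_cong)
qed

lemma ex_table:
  assumes f: "supportive m X 3 f"
  shows "\<exists>v<d ^ cells. valid f \<longleftrightarrow> valid (read_table (digit v))"
proof -
  \<comment> \<open>The digits of q are decoded to j, a, b, c. On arguments outside D_j the value of
    f may lie outside D; the default 0 keeps T a string of base-d digits.\<close>
  define T where "T q = (let u = [ds ! (q div d div d mod d), ds ! (q div d mod d), ds ! (q mod d)];
      a = index (f (q div d div d div d) u) in if a < d then a else 0)" for q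
  have "T q < d" if "q < cells" for q
  proof -
    have "0 < d" using that unfolding cells_def by (cases "d = 0") auto
    then show ?thesis by (simp add: T_def Let_def)
  qed
  then obtain v where v: "v < d ^ cells" "\<forall>q<cells. v div d ^ q mod d = T q"
    using ex_digits by blast
  have "f j [xs ! x ! j, xs ! y ! j, xs ! z ! j] =
      read_table (digit v) j [xs ! x ! j, xs ! y ! j, xs ! z ! j]"
    if j: "j < m" and xyz: "x < N" "y < N" "z < N" for j x y z
  proof -
    let ?u = "[xs ! x ! j, xs ! y ! j, xs ! z ! j]"
    let ?a = "index (xs ! x ! j)" and ?b = "index (xs ! y ! j)" and ?c = "index (xs ! z ! j)"
    have abc: "?a < d" "?b < d" "?c < d" "ds ! ?a = xs ! x ! j" "ds ! ?b = xs ! y ! j" "ds ! ?c = xs ! z ! j"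
      using index_mem entry_mem xyz j by blast+
    have "?u \<in> tuples (coord X j) 3" using xyz by (intro triple_in_tuples entry_coord)
    then have "f j ?u \<in> set ?u" using f j unfolding supportive_def by blast
    then have "f j ?u \<in> set ds" using entry_mem xyz j by auto
    note fu = index_mem[OF this]
    have "cell_index d j ?a ?b ?c < cells" using cell_index_less j abc by (simp add: cells_def)
    then have "digit v (cell_index d j ?a ?b ?c) = T (cell_index d j ?a ?b ?c)" using v(2) by (simp add: digit_def)
    also have "\<dots> = index (f j ?u)" using fu by (simp add: T_def Let_def cell_index_decode abc)
    finally show ?thesis using fu by (simp add: read_table_def eval_nat_numeral One_nat_def)
  qed
  from valid_cong[of f "read_table (digit v)", OF this] v(1) show ?thesis by blast
qed

lemma impossibility_iff_tables:
  "impossibility_domain m X \<longleftrightarrow> \<not> (\<exists>v<d ^ cells. good (layer tape v))"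
proof -
  have "(\<exists>f. nondictatorial_aggregator m X 3 f) \<longleftrightarrow> (\<exists>v<d ^ cells. good (layer tape v))"
  proof
    assume "\<exists>f. nondictatorial_aggregator m X 3 f"
    then obtain f where f: "nondictatorial_aggregator m X 3 f" by blast
    then have "supportive m X 3 f" by (simp add: nondictatorial_aggregator_def)
    from ex_table[OF this] f show "\<exists>v<d ^ cells. good (layer tape v)"
      using good_layer valid_iff by blast
  next
    assume "\<exists>v<d ^ cells. good (layer tape v)"
    then show "\<exists>f. nondictatorial_aggregator m X 3 f"
      using good_layer valid_iff by blast
  qed
  then show ?thesis by (simp add: impossibility_domain_iff_ternary)
qed

lemma answers_decide:
  "answers_within decide (encode ds m xs) (impossibility_domain m X)
     (real ((2 + N + m + d) ^ 160 * d ^ (m * d ^ 3)))"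
proof -
  have init: "initial (encode ds m xs) = \<lparr>reg = \<lambda>_. 0, mem = tape\<rparr>"
    by (simp add: initial_def tape_def fun_eq_iff)
  obtain t s' where "exec decide \<lparr>reg = \<lambda>_. 0, mem = tape\<rparr> t s'" "t \<le> (2 + N + m + d) ^ 160 * d ^ cells"
      "reg s' 0 = of_bool (\<not> (\<exists>v<d ^ cells. good (layer tape v)))"
    using exec_decide[OF tape_header tape_blank] by blast
  then show ?thesis
    unfolding answers_within_def impossibility_iff_tables init cells_def of_nat_le_iff of_bool_def by blast
qed

end

theorem theorem16:
  "\<exists>(c :: com) (p :: real poly poly poly) (C :: real). C > 0 \<and>
     (\<forall>(D :: nat set) (m :: nat) (X :: nat list set) ds xs.
        finite D \<and> X \<subseteq> tuples D m \<and>
        distinct ds \<and> set ds = D \<and> distinct xs \<and> set xs = X \<longrightarrow>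
        answers_within c (encode ds m xs) (impossibility_domain m X)
          (C * (poly3 p (real (card X)) (real m) (real (card D)) *
                real (card D) ^ (m * card D ^ 3))))"
proof (intro exI conjI allI impI)
  show "(1 :: real) > 0" by simp
next
  fix D :: "nat set" and m X ds xs
  assume *: "finite D \<and> X \<subseteq> tuples D m \<and> distinct ds \<and> set ds = D \<and> distinct xs \<and> set xs = X"
  then interpret instance_data ds m xs by unfold_locales auto
  have card: "card X = length xs" "card D = length ds" using * distinct_card by metis+
  \<comment> \<open>The polynomial is the 160th power of the time parameter L, with |X| as the
    outermost variable and |D| as the innermost.\<close>
  have "poly3 ([:[:[:2, 1:], 1:], 1:] ^ 160) x y z = (2 + x + y + z) ^ 160" for x y z :: real
    by (simp add: poly3_def poly_power algebra_simps)
  then show "answers_within decide (encode ds m xs) (impossibility_domain m X)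
      (1 * (poly3 ([:[:[:2, 1:], 1:], 1:] ^ 160) (real (card X)) (real m) (real (card D)) *
        real (card D) ^ (m * card D ^ 3)))"
    using answers_decide * unfolding card by (simp add: ac_simps)
qed

end
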